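(* Fix an integer $k\geq2$ and $\alpha\in\mathbb{C}$ with $\alpha\neq 0$, $|\alpha|<2$. Let $\lambda=\lambda(N)\in\mathbb{R}$ satisfy $\lambda=o(\log N)$ as $N\to\infty$, and put $\varepsilon=\frac{\lambda}{\log N}$. Then, as $N\to\infty$, $$\varphi_{\Omega,N}^{(k,\alpha)}(\lambda)=\varphi^{(\alpha)}(\lambda)\left(1+O\!\left(\frac{1}{\log N}\right)+O(\varepsilon\log|\varepsilon|)\right),$$ where the constants implied by the $O$-notation depend only on $k$ and $\alpha$.
   Context: For $N\geq2$ let $\mathfrak X_N^{(k)}=\{x=\prod_{p\leq N}p^{\nu(p)}:\ 0\leq\nu(p)\leq k-1\}$ be the set of $k$-free positive integers all of whose prime factors are $\leq N$ (here $p$ runs over primes). Let $\Omega(x)$ be the number of prime factors of $x$ with multiplicity. Define the complex measure $P^{(\alpha)}_\Omega(X)=\sum_{x\in X}\alpha^{\Omega(x)}/x$ for $X\subseteq\mathfrak X_N^{(k)}$, the partition function $Z_{\Omega,N}^{(k,\alpha)}=P^{(\alpha)}_\Omega(\mathfrak X_N^{(k)})=\prod_{p\leq N}\left(1+\frac{\alpha}{p}+\dots+\frac{\alpha^{k-1}}{p^{k-1}}\right)$ (nonzero for $|\alpha|<2$), and the normalized measure $P_{\Omega,N}^{(k,\alpha)}=(Z_{\Omega,N}^{(k,\alpha)})^{-1}P^{(\alpha)}_\Omega$. Let $\xi_N(x)=\frac{\log x}{\log N}$ for $x\in\mathfrak X_N^{(k)}$, and $$\varphi_{\Omega,N}^{(k,\alpha)}(\lambda)=\sum_{x\in\mathfrak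 X_N^{(k)}}e^{i\lambda\xi_N(x)}P_{\Omega,N}^{(k,\alpha)}(\{x\}).$$ Finally $\varphi^{(\alpha)}(\lambda)=\exp\{\alpha\int_0^1\frac{e^{i\lambda v}-1}{v}\mathrm{d}v\}$. *)

theory Defs
  imports
    "HOL-Analysis.Analysis"
    "HOL-Library.Landau_Symbols"
    "HOL-Computational_Algebra.Primes"
begin

definition kfree_smooth :: "nat \<Rightarrow> nat \<Rightarrow> nat set" where
  "kfree_smooth k N =
     {(\<Prod>p | prime p \<and> p \<le> N. p ^ \<nu> p) | \<nu>. \<forall>p. prime p \<and> p \<le> N \<longrightarrow> \<nu> p \<le> k - 1}"

lemma finite_kfree_smooth: "finite (kfree_smooth k N)"
proof -
  let ?P = "{p::nat. prime p \<and> p \<le> N}"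
  let ?f = "\<lambda>\<nu>::nat \<Rightarrow> nat. \<Prod>p\<in>?P. p ^ \<nu> p"
  have "finite ?P" by simp
  then have "finite (?f ` (\<Pi>\<^sub>E p\<in>?P. {..k - 1}))"
    by (intro finite_imageI finite_PiE) auto
  moreover have "kfree_smooth k N \<subseteq> ?f ` (\<Pi>\<^sub>E p\<in>?P. {..k - 1})"
  proof
    fix x assume "x \<in> kfree_smooth k N"
    then obtain \<nu> where \<nu>: "x = ?f \<nu>" "\<forall>p. prime p \<and> p \<le> N \<longrightarrow> \<nu> p \<le> k - 1"
      by (auto simp: kfree_smooth_def)
    have "x = ?f (restrict \<nu> ?P)" unfolding \<nu>(1) by (intro prod.cong) auto
    moreover have "restrict \<nu> ?P \<in> (\<Pi>\<^sub>E p\<in>?P. {..k - 1})" using \<nu>(2) by auto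
    ultimately show "x \<in> ?f ` (\<Pi>\<^sub>E p\<in>?P. {..k - 1})" by blast
  qed
  ultimately show ?thesis by (rule finite_subset[rotated])
qed

definition big_omega :: "nat \<Rightarrow> nat" where
  "big_omega x = size (prime_factorization x)"

definition P_Omega :: "complex \<Rightarrow> nat set \<Rightarrow> complex" where
  "P_Omega \<alpha> X = (\<Sum>x\<in>X. \<alpha> ^ big_omega x / of_nat x)"

definition Z_Omega :: "nat \<Rightarrow> complex \<Rightarrow> nat \<Rightarrow> complex" where
  "Z_Omega k \<alpha> N = P_Omega \<alpha> (kfree_smooth k N)"

definition P_Omega_norm :: "nat \<Rightarrow> complex \<Rightarrow> nat \<Rightarrow> nat set \<Rightarrow> complex" where
  "P_Omega_norm k \<alpha> N X = inverse (Z_Omega k \<alpha> N) * P_Omega \<alpha> X"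

definition xi :: "nat \<Rightarrow> nat \<Rightarrow> real" where
  "xi N x = ln (real x) / ln (real N)"

definition phi_Omega :: "nat \<Rightarrow> complex \<Rightarrow> nat \<Rightarrow> real \<Rightarrow> complex" where
  "phi_Omega k \<alpha> N t =
     (\<Sum>x\<in>kfree_smooth k N. exp (\<i> * of_real (t * xi N x)) * P_Omega_norm k \<alpha> N {x})"

text \<open>
  The integrand below extends continuously to \<open>v = 0\<close>; its value there under division
  by zero does not affect the integral.
\<close>

definition phi_limit :: "complex \<Rightarrow> real \<Rightarrow> complex" where
  "phi_limit \<alpha> t =
     exp (\<alpha> * integral {0..1} (\<lambda>v::real. (exp (\<i> * of_real (t * v)) - 1) / of_real v))"

end

theory Submission
  imports Defs "HOL-Number_Theory.Prime_Powers" "HOL-Complex_Analysis.Complex_Analysis"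
begin

text \<open>
  With \<open>e = t / ln N\<close>, the characteristic function is the product over \<open>p \<le> N\<close> of
  \<open>f(\<alpha> p\<^sup>i\<^sup>e / p) / f(\<alpha> / p)\<close>, where \<open>f(z) = 1 + z + \<dots> + z ^ (k - 1)\<close>. As \<open>f(z) exp(-z)\<close>
  has derivative \<open>O(z)\<close>, the product is \<open>exp (\<alpha> S) (1 + O(e))\<close> with
  \<open>S = \<Sum> (p\<^sup>i\<^sup>e - 1) / p\<close>, and it remains to compare \<open>S\<close> with the integral
  \<open>\<integral> (exp(itv) - 1) / v dv\<close> over \<open>[0,1]\<close> up to \<open>O(e)\<close>; the error terms \<open>O(1 / ln N)\<close> and the factor
  \<open>ln e\<close> are not needed.

  Mertens' theorem alone controls only the primes with \<open>e ln p \<le> 1\<close>. For larger \<open>p\<close> the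
  essential point is that \<open>\<Sum> (\<Lambda>(n) - 1) n\<^sup>i\<^sup>e / n\<close> over \<open>n \<le> N\<close> is bounded uniformly in \<open>N\<close> and in small
  \<open>e \<noteq> 0\<close>. No zero-free region is involved: near \<open>s = 1\<close> only the pole of the zeta function
  matters, and twisting the identity \<open>\<Lambda> * 1 = ln\<close> by \<open>n\<^sup>i\<^sup>e / n\<close> turns Mertens' theorem
  into this bound, because the constant term \<open>Z\<close> of \<open>\<Sum> n\<^sup>i\<^sup>e / n\<close> has size about \<open>1 / e\<close>.
\<close>

section \<open>Chebyshev and Mertens bounds\<close>

text \<open>Both sides run over the pairs \<open>(n, m)\<close> of positive integers with
  \<open>n * m <= N\<close>, grouped on the left by \<open>n\<close> and on the right by the product
  \<open>l = n * m\<close>.\<close>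

lemma sum_divisors_convolution:
  fixes a h :: "nat \<Rightarrow> 'a :: comm_semiring_1"
  shows "(\<Sum>n=1..N. a n * (\<Sum>m=1..N div n. h (n * m))) =
         (\<Sum>l=1..N. (\<Sum>d | d dvd l. a d) * h l)"
proof -
  have "(\<Sum>n=1..N. a n * (\<Sum>m=1..N div n. h (n * m))) =
        (\<Sum>(n,m)\<in>Sigma {1..N} (\<lambda>n. {1..N div n}). a n * h (n * m))"
    by (simp add: sum_distrib_left sum.Sigma)
  also have "\<dots> = (\<Sum>(l,d)\<in>Sigma {1..N} (\<lambda>l. {d. d dvd l}). a d * h l)"
  proof (rule sum.reindex_bij_witness[of _ "\<lambda>(l,d). (d, l div d)" "\<lambda>(n,m). (n * m, n)"], goal_cases)
    case (2 x)
    obtain n m where x: "x = (n, m)" by force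
    with 2 have "1 \<le> n" "1 \<le> m" "m \<le> N div n" by auto
    hence "n * m \<le> n * (N div n)" by simp
    also have "\<dots> \<le> N" by simp
    finally show ?case using \<open>1 \<le> n\<close> \<open>1 \<le> m\<close> by (auto simp: x)
  next
    case (4 x)
    obtain l d where x: "x = (l, d)" by force
    with 4 have *: "1 \<le> l" "l \<le> N" "d dvd l" by auto
    hence "d > 0" "d \<le> l" by (auto intro: Nat.gr0I dvd_imp_le)
    with * show ?case
      by (auto simp: x div_le_mono Suc_le_eq div_greater_zero_iff)
  qed (auto simp: mult.commute)
  also have "\<dots> = (\<Sum>l=1..N. \<Sum>d | d dvd l. a d * h l)"
    by (subst sum.Sigma) (auto simp: Suc_le_eq)
  finally show ?thesis by (simp add: sum_distrib_right)
qed

text \<open>The values of \<open>mangoldt\<close> over the divisors of \<open>l\<close> add up to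
  \<open>ln l\<close>. The choice \<open>h = 1\<close> leads to the Chebyshev and Mertens bounds,
  and h(n) = n^(ie) / n to the twisted bound.\<close>

lemma sum_mangoldt_convolution:
  fixes h :: "nat \<Rightarrow> 'a :: {real_algebra_1, comm_ring_1}"
  shows "(\<Sum>n=1..N. mangoldt n * (\<Sum>m=1..N div n. h (n * m))) =
         (\<Sum>l=1..N. of_real (ln (real l)) * h l)"
  unfolding sum_divisors_convolution by (intro sum.cong) (auto simp: mangoldt_sum)

lemma ln_fact_eq_sum_mangoldt:
  "ln (fact N) = (\<Sum>n=1..N. mangoldt n * real (N div n))"
proof -
  have "ln (fact N) = (\<Sum>l=1..N. ln (real l))"
    by (induction N) (auto simp: ln_mult)
  thus ?thesis using sum_mangoldt_convolution[of "\<lambda>_. 1 :: real" N] by simp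
qed

text \<open>This is the bound \<open>2 ^ n\<close> on a middle binomial coefficient. Bounding
  \<open>n - m\<close> by \<open>Suc m\<close> also covers odd \<open>n\<close>; the extra factor
  costs only \<open>ln (1 + m) <= m\<close>.\<close>

lemma ln_fact_half_bound:
  "ln (fact n) - 2 * ln (fact (n div 2)) \<le> 2 * real n"
proof -
  define m where "m = n div 2"
  have m: "m \<le> n" "n - m \<le> Suc m" by (auto simp: m_def)
  have "fact n = fact m * fact (n - m) * (n choose m)"
    using m(1) binomial_fact_lemma[of m n] by simp
  also have "\<dots> \<le> fact m * fact (Suc m) * 2 ^ n"
    using m by (intro mult_mono fact_mono binomial_le_pow2) auto
  finally have "real (fact n) \<le> real (fact m * fact (Suc m) * 2 ^ n)" by (rule of_nat_mono)
  hence "fact n \<le> (fact m * fact m * real (Suc m) * 2 ^ n :: real)" by (simp add: algebra_simps)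
  hence "ln (fact n) \<le> ln (fact m * fact m * real (Suc m) * 2 ^ n :: real)"
    by (subst ln_le_cancel_iff) auto
  also have "\<dots> = 2 * ln (fact m) + ln (1 + real m) + n * ln 2"
    by (simp add: ln_mult ln_realpow)
  also have "ln (1 + real m) \<le> real m" by (rule ln_add_one_self_le_self) auto
  also have "n * ln 2 \<le> real n * 1" using ln_2_less_1 by (intro mult_left_mono) auto
  finally show ?thesis using m by (simp add: m_def)
qed

text \<open>Chebyshev's halving argument: the range above \<open>n div 2\<close> contributes at most
  \<open>2 * n\<close>, and \<open>2 * n + 4 * (n div 2) <= 4 * n\<close> closes the
  induction.\<close>

lemma sum_mangoldt_le: "(\<Sum>j=1..n. mangoldt j) \<le> 4 * real n"
proof (induction n rule: less_induct)
  case (less n)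
  show ?case
  proof (cases "n = 0")
    case False
    define m where "m = n div 2"
    have m: "m < n" "m \<le> n" using False by (auto simp: m_def)
    have "(\<Sum>j=1..n. mangoldt j) - (\<Sum>j=1..m. mangoldt j) = (\<Sum>j\<in>{1..n}-{1..m}. mangoldt j :: real)"
      using m by (subst sum_diff) auto
    also have "\<dots> = (\<Sum>j=1..n. mangoldt j * (if j \<le> m then 0 else 1))"
      by (intro sum.mono_neutral_cong_left) auto
    \<comment> \<open>The weight \<open>n div j - 2 * (m div j)\<close> is never negative, and for
      \<open>j > m\<close> it is at least 1 because \<open>m div j\<close> vanishes. It turns the
      sum into a difference of log factorials.\<close>
    also have "\<dots> \<le> (\<Sum>j=1..n. mangoldt j * (real (n div j) - 2 * real (m div j)))"
    proof (intro sum_mono mult_left_mono)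
      fix j assume j: "j \<in> {1..n}"
      show "(if j \<le> m then 0 else 1) \<le> real (n div j) - 2 * real (m div j)"
      proof (cases "j \<le> m")
        case True
        have "2 * (m div j) \<le> (2 * m) div j" 
          using j by (simp add: less_eq_div_iff_mult_less_eq)
        also have "\<dots> \<le> n div j" by (intro div_le_mono) (auto simp: m_def)
        finally show ?thesis using True by simp
      next
        case False
        have "1 \<le> n div j" using j by (simp add: less_eq_div_iff_mult_less_eq)
        thus ?thesis using False by simp
      qed
    qed (auto simp: mangoldt_nonneg)
    also have "\<dots> = (\<Sum>j=1..n. mangoldt j * real (n div j)) - 2 * (\<Sum>j=1..n. mangoldt j * real (m div j))"
      by (simp add: sum_subtractf sum_distrib_left algebra_simps)
    also have "(\<Sum>j=1..n. mangoldt j * real (m div j)) = (\<Sum>j=1..m. mangoldt j * real (m div j))"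
      using m by (intro sum.mono_neutral_right) auto
    also have "(\<Sum>j=1..n. mangoldt j * real (n div j)) - 2 * \<dots> = ln (fact n) - 2 * ln (fact m)"
      by (simp add: ln_fact_eq_sum_mangoldt)
    also have "\<dots> \<le> 2 * real n" unfolding m_def by (rule ln_fact_half_bound)
    finally show ?thesis using less.IH[OF m(1)] by (auto simp: m_def)
  qed auto
qed

text \<open>A weak Stirling bound, whose induction step rests on
  \<open>n * (ln (n + 1) - ln n) <= 1\<close>.\<close>

lemma ln_fact_ge: "real n * ln (real n) - real n \<le> ln (fact n)"
proof (induction n)
  case (Suc n)
  show ?case
  proof (cases "n = 0")
    case False
    have "ln (real (Suc n)) - ln (real n) \<le> (real (Suc n) - real n) / real n"
      using False by (intro ln_diff_le) auto
    hence "real n * (ln (real (Suc n)) - ln (real n)) \<le> 1"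
      using False by (simp add: field_simps)
    moreover have "ln (fact (Suc n)) = ln (real (Suc n)) + ln (fact n :: real)"
      by (simp add: ln_mult)
    ultimately show ?thesis using Suc.IH by (simp add: algebra_simps)
  qed auto
qed auto

text \<open>Replacing \<open>N div n\<close> by \<open>N / n\<close> in the formula for
  \<open>ln (fact N)\<close> costs at most one \<open>mangoldt n\<close> per term, in total
  \<open>4 * N\<close> by Chebyshev. The factorial itself lies within \<open>N\<close> of
  \<open>N * ln N\<close>.\<close>

lemma mertens_mangoldt:
  assumes "N \<ge> 1"
  shows "\<bar>(\<Sum>n=1..N. mangoldt n / real n) - ln (real N)\<bar> \<le> 4"
proof -
  define M where "M = (\<Sum>n=1..N. mangoldt n / real n)"
  have "ln (fact N) \<le> N * M"
    unfolding ln_fact_eq_sum_mangoldt M_def sum_distrib_left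
  proof (intro sum_mono)
    fix n assume "n \<in> {1..N}"
    have "mangoldt n * real (N div n) \<le> mangoldt n * (real N / real n)"
      by (intro mult_left_mono of_nat_div_le_of_nat) (auto simp: mangoldt_nonneg)
    thus "mangoldt n * real (N div n) \<le> real N * (mangoldt n / real n)" by (simp add: field_simps)
  qed
  moreover have "N * M \<le> ln (fact N) + (\<Sum>n=1..N. mangoldt n)"
    unfolding ln_fact_eq_sum_mangoldt M_def sum_distrib_left sum.distrib[symmetric]
  proof (intro sum_mono)
    fix n assume "n \<in> {1..N}"
    hence "real N \<le> real (n + n * (N div n))"
      using dividend_less_times_div[of n N] by (intro of_nat_mono) auto
    hence "real N / real n \<le> real (N div n) + 1"
      using \<open>n \<in> _\<close> by (simp add: field_simps)
    hence "mangoldt n * (real N / real n) \<le> mangoldt n * (real (N div n) + 1)"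
      by (intro mult_left_mono) (auto simp: mangoldt_nonneg)
    thus "real N * (mangoldt n / real n) \<le> mangoldt n * real (N div n) + mangoldt n"
      by (simp add: field_simps)
  qed
  moreover have "ln (fact N) \<le> N * ln N"
  proof -
    have "ln (fact N) \<le> ln (real N ^ N)"
      using assms fact_le_power[of N] by (subst ln_le_cancel_iff) auto
    thus ?thesis using assms by (simp add: ln_realpow)
  qed
  ultimately have "N * M \<le> N * (ln N + 4)" "N * (ln N - 1) \<le> N * M"
    using sum_mangoldt_le[of N] ln_fact_ge[of N] by (auto simp: algebra_simps)
  hence "M \<le> ln N + 4" "ln N - 1 \<le> M" using assms by auto
  thus ?thesis unfolding M_def[symmetric] by auto
qed

section \<open>Twisted harmonic sums\<close>

lemma norm_cis_diff_le: "norm (cis a - cis b) \<le> \<bar>a - b\<bar>"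
proof -
  have "cis a - cis b = cis b * (exp (\<i> * of_real (a - b)) - 1)"
    by (simp add: cis_conv_exp algebra_simps flip: exp_add)
  hence "norm (cis a - cis b) = 2 * \<bar>sin ((a - b) / 2)\<bar>"
    using dist_exp_i_1[of "a - b"] by (simp add: norm_mult)
  also have "\<dots> \<le> 2 * \<bar>(a - b) / 2\<bar>"
    by (intro mult_left_mono abs_sin_x_le_abs_x) auto
  finally show ?thesis by simp
qed

text \<open>One step of Euler-Maclaurin summation: on a unit interval \<open>f\<close> stays within
  \<open>K\<close> of its right end value, hence so does its mean, the increment of
  \<open>F\<close>.\<close>

lemma primitive_step_bound:
  fixes F f g :: "real \<Rightarrow> complex"
  assumes "\<And>t. t \<in> {a..a+1} \<Longrightarrow> (F has_vector_derivative f t) (at t)"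
    and "\<And>t. t \<in> {a..a+1} \<Longrightarrow> (f has_vector_derivative g t) (at t)"
    and "\<And>t. t \<in> {a..a+1} \<Longrightarrow> norm (g t) \<le> K"
  shows "norm (f (a + 1) - (F (a + 1) - F a)) \<le> K"
proof -
  have K: "0 \<le> K" using order.trans[OF norm_ge_zero assms(3)[of a]] by auto
  have 1: "norm (f t - f (a + 1)) \<le> K" if t: "t \<in> {a..a+1}" for t
  proof -
    have "norm (f t - f (a + 1)) \<le> K * norm (t - (a + 1))"
    proof (rule differentiable_bound[of "{a..a+1}"])
      fix x assume "x \<in> {a..a+1}"
      show "(f has_derivative (\<lambda>h. h *\<^sub>R g x)) (at x within {a..a+1})"
        using assms(2)[OF \<open>x \<in> _\<close>] 
        by (simp add: has_vector_derivative_def has_derivative_at_withinI)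
      show "onorm (\<lambda>h. h *\<^sub>R g x) \<le> K"
        using mult_left_mono[OF assms(3)[OF \<open>x \<in> _\<close>] abs_ge_zero]
        by (intro onorm_le) (simp add: mult.commute)
    qed (use t in auto)
    also have "\<dots> \<le> K * 1" using t K by (intro mult_left_mono) auto
    finally show ?thesis by simp
  qed
  have "norm (F (a+1) - F a - ((a+1) - a) *\<^sub>R f (a+1)) \<le> norm ((a+1) - a) * K"
    by (rule vector_differentiable_bound_linearization[where S = "{a..a+1}"])
       (use assms(1) 1 in \<open>auto simp: closed_segment_eq_real_ivl intro: has_vector_derivative_at_within\<close>)
  thus ?thesis by (simp add: norm_minus_commute)
qed

text \<open>Telescoping isolates the errors of the single steps, to which
  \<open>primitive_step_bound\<close> applies.\<close>

lemma sum_eq_primitive: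
  fixes F f :: "real \<Rightarrow> complex"
  assumes "m \<le> n"
  shows "(\<Sum>j=m..n. f (real j)) =
    f m + F n - F m + (\<Sum>j=m..<n. f (real j + 1) - (F (real j + 1) - F (real j)))"
  using assms by (induction n rule: dec_induct) (auto simp: algebra_simps)

lemma inverse_square_tail:
  fixes d :: "nat \<Rightarrow> 'a :: banach"
  assumes "\<And>n. norm (d n) \<le> K / (real n + 1) ^ 2"
  shows "norm (suminf d - (\<Sum>n<m. d n)) \<le> 2 * K / (real m + 1)"
proof -
  have K: "0 \<le> K" using order.trans[OF norm_ge_zero assms[of 0]] by simp
  \<comment> \<open>A telescoping majorant: \<open>e n\<close> is
    \<open>2 * K / ((n + 1) * (n + 2))\<close>, and \<open>n + 2 <= 2 * (n + 1)\<close>.\<close>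
  define e where "e = (\<lambda>n. 2 * K / (real n + 1) - 2 * K / (real (Suc n) + 1))"
  have de: "norm (d n) \<le> e n" for n
  proof -
    have "K / (real n + 1) ^ 2 \<le> K * (2 / ((real n + 1) * (real n + 2)))"
      using K mult_nonneg_nonneg[of K "real n"] by (simp add: divide_simps power2_eq_square) (simp add: algebra_simps)
    also have "\<dots> = e n" by (simp add: e_def divide_simps) (simp add: algebra_simps)
    finally show ?thesis using assms[of n] by linarith
  qed
  have lim: "(\<lambda>n. 2 * K / (real n + 1)) \<longlonglongrightarrow> 0"
    by real_asymp
  have e: "(\<lambda>n. e (n + m)) sums (2 * K / (real m + 1))"
    using telescope_sums'[OF LIMSEQ_ignore_initial_segment[OF lim, of m]] 
    by (simp add: e_def)
  have "summable e" using sums_summable[OF e] unfolding summable_iff_shift .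
  hence "summable d"
    by (rule summable_comparison_test'[of e 0]) (rule de)
  hence "suminf d - (\<Sum>n<m. d n) = (\<Sum>n. d (n + m))"
    by (rule suminf_minus_initial_segment [symmetric])
  also have "norm \<dots> \<le> (\<Sum>n. e (n + m))"
    by (rule norm_suminf_le[OF de sums_summable[OF e]])
  also have "\<dots> = 2 * K / (real m + 1)" by (rule sums_unique[OF e, symmetric])
  finally show ?thesis .
qed

lemma has_vector_derivative_cis_ln:
  assumes "t > 0"
  shows "((\<lambda>t. cis (e * ln t)) has_vector_derivative (\<i> * e / t * cis (e * ln t))) (at t)"
  unfolding has_vector_derivative_def using assms
  by (auto intro!: derivative_eq_intros simp: scaleR_conv_of_real divide_inverse)

text \<open>Since \<open>cis (e * ln m)\<close> is m^(ie), \<open>Z\<close> is the value of the zeta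
  function at 1 - ie, with polar part -1 / (ie). The derivative of t^(ie - 1) is O(1 / t^2)
  uniformly in \<open>e\<close>, so the step errors form a convergent series with tail O(1 /
  y).\<close>

lemma twisted_harmonic_sum:
  assumes "e \<noteq> 0" "\<bar>e\<bar> \<le> 1"
  obtains Z where "norm (Z + 1 / (\<i> * of_real e)) \<le> 5"
    "\<And>y. y \<ge> 1 \<Longrightarrow> norm ((\<Sum>m=1..y. cis (e * ln (real m)) / of_nat m) 
             - cis (e * ln (real y)) / (\<i> * of_real e) - Z) \<le> 4 / real y"
proof -
  define F where "F = (\<lambda>t. cis (e * ln t) / (\<i> * of_real e))"
  define f where "f = (\<lambda>t. of_real (1 / t) * cis (e * ln t))"
  define g where "g = (\<lambda>t. (\<i> * of_real e - 1) * cis (e * ln t) / of_real t ^ 2)"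
  \<comment> \<open>\<open>d n\<close> belongs to the step from \<open>n + 1\<close> to
    \<open>n + 2\<close>, so that the steps start at 1.\<close>
  define d where "d = (\<lambda>n. f (real n + 1 + 1) - (F (real n + 1 + 1) - F (real n + 1)))"
  have d: "norm (d n) \<le> 2 / (real n + 1)^2" for n
    unfolding d_def
  proof (rule primitive_step_bound)
    fix t assume t: "t \<in> {real n + 1..real n + 1 + 1}"
    hence t0: "t > 0" by auto
    show "(F has_vector_derivative f t) (at t)"
      unfolding F_def f_def using t0 assms
      by (auto intro!: derivative_eq_intros has_vector_derivative_cis_ln simp: field_simps)
    have inv': "((\<lambda>t. complex_of_real (1 / t)) has_vector_derivative of_real (- 1 / t ^ 2)) (at t)"
      using t0 by (intro has_vector_derivative_of_real)
        (auto intro!: derivative_eq_intros simp flip: has_real_derivative_iff_has_vector_derivative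
           simp: field_simps power2_eq_square)
    have "(f has_vector_derivative (of_real (1 / t) * (\<i> * e / t * cis (e * ln t)) + of_real (- 1 / t ^ 2) * cis (e * ln t))) (at t)"
      unfolding f_def by (intro has_vector_derivative_mult has_vector_derivative_cis_ln inv' t0)
    also have "of_real (1 / t) * (\<i> * e / t * cis (e * ln t)) + of_real (- 1 / t ^ 2) * cis (e * ln t) = g t"
      unfolding g_def using t0 by (simp add: field_simps power2_eq_square)
    finally show "(f has_vector_derivative g t) (at t)" .
    have "norm (\<i> * complex_of_real e - 1) \<le> 2"
      using assms norm_triangle_ineq4[of "\<i> * complex_of_real e" 1] by (simp add: norm_mult)
    hence "norm (g t) \<le> 2 / t ^ 2"
      using t0 unfolding g_def by (simp add: norm_mult norm_divide norm_power divide_right_mono)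
    also have "\<dots> \<le> 2 / (real n + 1)^2"
      using t by (intro divide_left_mono power_mono mult_pos_pos) auto
    finally show "norm (g t) \<le> 2 / (real n + 1)^2" .
  qed
  note tail = inverse_square_tail[of d 2, OF d]
  \<comment> \<open>The limit of the sum minus \<open>F y\<close>; the summand 1 is
    \<open>f 1\<close>. The tail bound with \<open>K = 2\<close> gives both constants: 5 is 1 + 4,
    and \<open>4 / y\<close> is the tail from index \<open>y - 1\<close>.\<close>
  define Z where "Z = 1 - F 1 + suminf d"
  show ?thesis
  proof (rule that[of Z])
    have "norm (Z + 1 / (\<i> * of_real e)) = norm (1 + suminf d)"
      by (simp add: Z_def F_def)
    also have "\<dots> \<le> 5" using tail[of 0] norm_triangle_ineq[of 1 "suminf d"] by simp
    finally show "norm (Z + 1 / (\<i> * of_real e)) \<le> 5" .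
  next
    fix y :: nat assume y: "y \<ge> 1"
    have "(\<Sum>m=1..y. cis (e * ln (real m)) / of_nat m) = (\<Sum>m=1..y. f (real m))"
      by (simp add: f_def)
    also have "\<dots> = 1 + F y - F 1 + (\<Sum>j=1..<y. f (real j + 1) - (F (real j + 1) - F (real j)))"
      by (subst sum_eq_primitive[OF y, of f F]) (simp add: f_def)
    also have "(\<Sum>j=1..<y. f (real j + 1) - (F (real j + 1) - F (real j))) = (\<Sum>j<y-1. d j)"
      by (rule sum.reindex_bij_witness[of _ Suc "\<lambda>j. j - 1"]) (auto simp: d_def of_nat_diff add_ac)
    finally have "(\<Sum>m=1..y. cis (e * ln (real m)) / of_nat m) - F y - Z = 
                  - (suminf d - (\<Sum>j<y-1. d j))" by (simp add: Z_def)
    also have "norm \<dots> \<le> 4 / real y"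
      using tail[of "y - 1"] y by (simp add: of_nat_diff norm_minus_commute)
    finally show "norm ((\<Sum>m=1..y. cis (e * ln (real m)) / of_nat m) 
             - cis (e * ln (real y)) / (\<i> * of_real e) - Z) \<le> 4 / real y" by (simp add: F_def)
  qed
qed

text \<open>The sum is compared with the integral of t^(ie - 1) ln t. Integration by parts yields
  the primitive \<open>F\<close>, whose value at 1 is \<open>1 / e ^ 2\<close>, and the step errors
  are dominated by a convergent series free of \<open>e\<close> and \<open>N\<close>.\<close>

lemma twisted_log_sum:
  obtains C where "\<And>e N. e \<noteq> 0 \<Longrightarrow> \<bar>e\<bar> \<le> 1 \<Longrightarrow> N \<ge> 1 \<Longrightarrow>
     norm ((\<Sum>l=1..N. of_real (ln (real l)) * (cis (e * ln (real l)) / of_nat l)) -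
       (cis (e * ln (real N)) * of_real (ln (real N)) / (\<i> * of_real e)
        + cis (e * ln (real N)) / of_real e ^ 2 - 1 / of_real e ^ 2)) \<le> C"
proof
  fix e :: real and N :: nat
  assume e: "e \<noteq> 0" "\<bar>e\<bar> \<le> 1" and N: "N \<ge> 1"
  define F where "F = (\<lambda>t. cis (e * ln t) * of_real (ln t) / (\<i> * of_real e)
                         + cis (e * ln t) / of_real e ^ 2)"
  define f where "f = (\<lambda>t. of_real (ln t / t) * cis (e * ln t))"
  define g where "g = (\<lambda>t. (\<i> * of_real e * of_real (ln t) + 1 - of_real (ln t)) * cis (e * ln t) / of_real t ^ 2)"
  have d: "norm (f (real n + 1) - (F (real n + 1) - F (real n))) \<le> 5 * real n powr (-3/2)"
    if n: "n \<ge> 1" for n :: nat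
  proof (rule primitive_step_bound)
    fix t assume t: "t \<in> {real n..real n + 1}"
    hence t0: "t > 0" "t \<ge> 1" using n by auto
    have ln': "((\<lambda>t. complex_of_real (ln t)) has_vector_derivative of_real (1 / t)) (at t)"
      using t0 by (intro has_vector_derivative_of_real)
        (auto intro!: derivative_eq_intros simp flip: has_real_derivative_iff_has_vector_derivative simp: field_simps)
    show "(F has_vector_derivative f t) (at t)"
      unfolding F_def f_def using t0 e
      by (auto intro!: derivative_eq_intros has_vector_derivative_cis_ln ln'
            simp: field_simps power2_eq_square)
    have ln_div': "((\<lambda>t. complex_of_real (ln t / t)) has_vector_derivative of_real ((1 - ln t) / t ^ 2)) (at t)"
      using t0 by (intro has_vector_derivative_of_real)
        (auto intro!: derivative_eq_intros simp flip: has_real_derivative_iff_has_vector_derivative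
           simp: field_simps power2_eq_square)
    have "(f has_vector_derivative (of_real (ln t / t) * (\<i> * e / t * cis (e * ln t)) + of_real ((1 - ln t) / t ^ 2) * cis (e * ln t))) (at t)"
      unfolding f_def by (intro has_vector_derivative_mult has_vector_derivative_cis_ln ln_div' t0)
    also have "of_real (ln t / t) * (\<i> * e / t * cis (e * ln t)) + of_real ((1 - ln t) / t ^ 2) * cis (e * ln t) = g t"
      unfolding g_def using t0 by (simp add: field_simps power2_eq_square)
    finally show "(f has_vector_derivative g t) (at t)" .
    \<comment> \<open>Applying \<open>ln x <= x\<close> to \<open>sqrt t\<close> trades the
      logarithm for a half power, so that \<open>1 + 2 * ln t <= 5 * sqrt t\<close>.\<close>
    have lnt: "0 \<le> ln t" "ln t \<le> 2 * sqrt t" "1 \<le> sqrt t"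
      using t0 ln_bound[of "sqrt t"] by (auto simp: ln_sqrt)
    have "norm (\<i> * of_real e * of_real (ln t) + 1 - of_real (ln t) :: complex)
        \<le> norm (\<i> * of_real e * of_real (ln t) :: complex) + norm (1 :: complex) 
          + norm (of_real (ln t) :: complex)"
      by (meson norm_triangle_ineq norm_triangle_ineq4 order_trans add_right_mono)
    also have "\<dots> = \<bar>e\<bar> * ln t + 1 + ln t" using lnt by (simp add: norm_mult)
    also have "\<dots> \<le> 1 * ln t + 1 + ln t" using lnt e by (intro add_mono mult_right_mono) auto
    also have "\<dots> \<le> 5 * sqrt t" using lnt by linarith
    finally have "norm (g t) \<le> 5 * sqrt t / t ^ 2"
      using t0 unfolding g_def by (simp add: norm_mult norm_divide norm_power divide_right_mono)
    also have "sqrt t / t ^ 2 = t powr (-3/2)"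
      using t0 by (simp add: powr_half_sqrt [symmetric] powr_diff [symmetric] flip: powr_numeral)
    hence "5 * sqrt t / t ^ 2 = 5 * t powr (-3/2)" by simp
    also have "\<dots> \<le> 5 * real n powr (-3/2)"
      using t n by (intro mult_left_mono powr_mono2') auto
    finally show "norm (g t) \<le> 5 * real n powr (-3/2)" .
  qed
  have "(\<Sum>l=1..N. of_real (ln (real l)) * (cis (e * ln (real l)) / of_nat l)) = (\<Sum>l=1..N. f (real l))"
    by (simp add: f_def)
  also have "\<dots> - (F N - F 1) = (\<Sum>j=1..<N. f (real j + 1) - (F (real j + 1) - F (real j)))"
    by (subst sum_eq_primitive[OF N, of f F]) (simp add: f_def)
  also have "norm \<dots> \<le> (\<Sum>j=1..<N. 5 * real j powr (-3/2))"
    by (intro sum_norm_le d) auto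
  also have "\<dots> \<le> (\<Sum>j. 5 * real j powr (-3/2))"
    by (intro sum_le_suminf summable_mult) (auto simp: summable_real_powr_iff)
  finally show "norm ((\<Sum>l=1..N. of_real (ln (real l)) * (cis (e * ln (real l)) / of_nat l)) -
       (cis (e * ln (real N)) * of_real (ln (real N)) / (\<i> * of_real e)
        + cis (e * ln (real N)) / of_real e ^ 2 - 1 / of_real e ^ 2)) \<le> (\<Sum>j. 5 * real j powr (-3/2))"
    by (simp add: F_def)
qed

section \<open>The twisted Mertens bound\<close>

text \<open>With \<open>y = N div n\<close> one has
  \<open>n * y <= N < n * (y + 1) <= 2 * n * y\<close>. This controls the replacement of
  \<open>N / n\<close> by its integer part in the twisted sums.\<close>

lemma ln_floor_div:
  assumes "1 \<le> n" "n \<le> N"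
  shows "\<bar>ln (real N) - ln (real n) - ln (real (N div n))\<bar> \<le> 1 / real (N div n)"
    and "1 / real (N div n) \<le> 2 * real n / real N" and "1 \<le> N div n"
proof -
  define y where "y = N div n"
  show y1: "1 \<le> N div n" using assms by (simp add: less_eq_div_iff_mult_less_eq)
  hence y: "y \<ge> 1" by (simp add: y_def)
  have "n * y \<le> N" unfolding y_def by simp
  hence lo: "real n * y \<le> N" by (metis of_nat_le_iff of_nat_mult)
  have "N < n + n * y" using dividend_less_times_div[of n N] assms by (simp add: y_def)
  hence "real N < real (n + n * y)" by (subst of_nat_less_iff)
  hence hi: "real N < real n * (y + 1)" by (simp add: algebra_simps)
  have "ln (real N) - ln (real n * y) \<le> (real N - real n * y) / (real n * y)"
    using y assms by (intro ln_diff_le) auto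
  also have "\<dots> \<le> real n / (real n * y)"
    using hi by (intro divide_right_mono) (auto simp: algebra_simps)
  also have "\<dots> = 1 / y" using assms by simp
  finally have "ln (real N) - ln (real n * y) \<le> 1 / y" .
  moreover have "ln (real n * y) \<le> ln (real N)" using lo y assms by (subst ln_le_cancel_iff) auto
  moreover have "ln (real n * y) = ln n + ln y" using y assms by (simp add: ln_mult)
  ultimately show "\<bar>ln (real N) - ln (real n) - ln (real (N div n))\<bar> \<le> 1 / real (N div n)"
    unfolding y_def[symmetric] by linarith
  have "real n * 1 \<le> real n * y" using y by (intro mult_left_mono) auto
  hence "real N \<le> 2 * real n * y" using hi by (simp add: algebra_simps)
  thus "1 / real (N div n) \<le> 2 * real n / real N"
    unfolding y_def[symmetric] using y assms by (simp add: field_simps)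
qed

text \<open>The sum \<open>T\<close> is evaluated twice: directly by \<open>twisted_log_sum\<close>,
  and by convolution as \<open>M * Z + c * w * M0\<close> up to a bounded error. Comparison gives
  \<open>M * Z\<close>, and Mertens removes \<open>c * w * L\<close>.\<close>

lemma twisted_mangoldt_sum:
  obtains C where "\<And>e N. e \<noteq> 0 \<Longrightarrow> \<bar>e\<bar> \<le> 1/10 \<Longrightarrow> N \<ge> 1 \<Longrightarrow>
     norm (\<Sum>n=1..N. (mangoldt n - 1) * (cis (e * ln (real n)) / of_nat n)) \<le> C"
proof -
  obtain C where C: "\<And>e N. e \<noteq> 0 \<Longrightarrow> \<bar>e\<bar> \<le> 1 \<Longrightarrow> N \<ge> 1 \<Longrightarrow>
     norm ((\<Sum>l=1..N. of_real (ln (real l)) * (cis (e * ln (real l)) / of_nat l)) -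
       (cis (e * ln (real N)) * of_real (ln (real N)) / (\<i> * of_real e)
        + cis (e * ln (real N)) / of_real e ^ 2 - 1 / of_real e ^ 2)) \<le> C"
    by (rule twisted_log_sum) blast
  show ?thesis
  proof (rule that)
    fix e :: real and N :: nat
    assume e: "e \<noteq> 0" "\<bar>e\<bar> \<le> 1/10" and N: "N \<ge> 1"
    define f where "f = (\<lambda>n. cis (e * ln (real n)) / of_nat n)"
    define w where "w = 1 / (\<i> * complex_of_real e)"
    define c where "c = cis (e * ln (real N))"
    define S where "S = (\<lambda>y. \<Sum>m=1..y. f m)"
    define L where "L = complex_of_real (ln (real N))"
    define M where "M = (\<Sum>n=1..N. mangoldt n * f n)"
    define M0 where "M0 = (\<Sum>n=1..N. mangoldt n / of_nat n :: complex)"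
    define T where "T = (\<Sum>l=1..N. of_real (ln (real l)) * f l)"
    obtain Z where Z: "norm (Z + 1 / (\<i> * of_real e)) \<le> 5"
      "\<And>y. y \<ge> 1 \<Longrightarrow> norm ((\<Sum>m=1..y. cis (e * ln (real m)) / of_nat m) 
               - cis (e * ln (real y)) / (\<i> * of_real e) - Z) \<le> 4 / real y"
      using twisted_harmonic_sum[of e] e by auto
    \<comment> \<open>\<open>Z\<close> is the large number \<open>- w\<close> up to the bounded
      remainder \<open>\<gamma>\<close>.\<close>
    define \<gamma> where "\<gamma> = Z + w"
    have S: "norm (S y - cis (e * ln (real y)) * w - Z) \<le> 4 / real y" if "y \<ge> 1" for y
      using Z(2)[OF that] by (simp add: S_def f_def w_def)
    have \<gamma>: "norm \<gamma> \<le> 5" using Z(1) by (simp add: \<gamma>_def w_def)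
    have nw: "norm w = 1 / \<bar>e\<bar>" by (simp add: w_def norm_divide norm_mult)
    \<comment> \<open>The range |e| <= 1/10 makes \<open>norm w\<close> at least twice the bound 5
      on \<open>\<gamma>\<close>, whence \<open>norm Z >= norm w / 2\<close> at the end.\<close>
    have nw10: "norm w \<ge> 10" using e by (simp add: nw field_simps)
    have w2: "w ^ 2 = - 1 / of_real e ^ 2" by (simp add: w_def power2_eq_square field_simps)
    have f_mult: "f (n * m) = f n * f m" if "n \<ge> 1" "m \<ge> 1" for n m
      using that by (simp add: f_def ln_mult cis_mult ring_distribs)
    have nc: "norm c = 1" by (simp add: c_def)

    \<comment> \<open>\<open>\<tau>\<close> and \<open>\<sigma>\<close> are the errors of the two
      evaluations of \<open>T\<close>. The main term behind \<open>\<sigma>\<close> arises from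
      n^(ie) (N/n)^(ie) = N^(ie), which is \<open>c\<close>.\<close>
    define \<tau> where "\<tau> = T - (c * L * w - c * w ^ 2 + w ^ 2)"
    have \<tau>: "norm \<tau> \<le> C"
      using C[of e N] e N by (simp add: \<tau>_def T_def f_def c_def L_def w2) (simp add: w_def)
    define \<sigma> where "\<sigma> = T - (M * Z + c * w * M0)"
    have \<sigma>: "norm \<sigma> \<le> 40"
    proof -
      have "T = (\<Sum>n=1..N. mangoldt n * (\<Sum>m=1..N div n. f (n * m)))"
        unfolding T_def by (rule sum_mangoldt_convolution [symmetric])
      also have "\<dots> = (\<Sum>n=1..N. mangoldt n * f n * S (N div n))"
        unfolding S_def mult.assoc sum_distrib_left
        by (intro sum.cong refl) (simp add: f_mult)
      finally have "\<sigma> = (\<Sum>n=1..N. mangoldt n * f n * S (N div n) - (mangoldt n * f n * Z 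
                             + c * w * (mangoldt n / of_nat n)))"
        by (simp add: \<sigma>_def M_def M0_def sum_distrib_left sum_distrib_right sum.distrib sum_subtractf)
      also have "\<dots> = (\<Sum>n=1..N. mangoldt n * f n *
          (S (N div n) - cis (e * ln (real (N div n))) * w - Z + 
            (cis (e * ln (real (N div n))) - cis (e * (ln N - ln n))) * w))" (is "_ = sum ?h _")
      proof (intro sum.cong refl)
        fix n assume n: "n \<in> {1..N}"
        have "f n * cis (e * (ln N - ln n)) = c / of_nat n"
          by (simp add: f_def c_def cis_mult ring_distribs)
        thus "mangoldt n * f n * S (N div n) - (mangoldt n * f n * Z + c * w * (mangoldt n / of_nat n)) = ?h n"
          by (simp add: algebra_simps)
      qed
      \<comment> \<open>Each bracket is at most \<open>5 / y\<close>: \<open>4 / y\<close> from the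
        asymptotics of \<open>S\<close>, and \<open>1 / y\<close> from rounding, where the small |e|
        cancels the large \<open>norm w\<close>. As \<open>1 / y <= 2 * n / N\<close>, the factor
        \<open>n\<close> cancels against \<open>f n\<close>, and Chebyshev turns 10 into 40.\<close>
      also have "norm \<dots> \<le> (\<Sum>n=1..N. 10 * mangoldt n / N)"
      proof (intro sum_norm_le)
        fix n assume n: "n \<in> {1..N}"
        define y where "y = N div n"
        have y: "1 \<le> y" "\<bar>ln (real N) - ln (real n) - ln (real y)\<bar> \<le> 1 / real y" "1 / real y \<le> 2 * real n / real N"
          using ln_floor_div[of n N] n by (auto simp: y_def)
        have "norm (cis (e * ln y) - cis (e * (ln N - ln n))) \<le> \<bar>e * ln y - e * (ln N - ln n)\<bar>"
          by (rule norm_cis_diff_le)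
        also have "\<dots> = \<bar>e\<bar> * \<bar>ln (real N) - ln (real n) - ln (real y)\<bar>"
          by (simp add: abs_mult[symmetric] ring_distribs)
        also have "\<dots> \<le> \<bar>e\<bar> * (1 / y)" using y by (intro mult_left_mono) auto
        finally have "norm ((cis (e * ln y) - cis (e * (ln N - ln n))) * w) \<le> (\<bar>e\<bar> * (1 / y)) * norm w"
          unfolding norm_mult by (intro mult_right_mono) auto
        also have "\<dots> = 1 / y" using e by (simp add: nw)
        finally have "norm (S y - cis (e * ln y) * w - Z + (cis (e * ln y) - cis (e * (ln N - ln n))) * w) \<le> 5 / y"
          using norm_triangle_le[OF add_mono[OF S[OF y(1)]]] by fastforce
        also have "\<dots> \<le> 10 * real n / N" using y by simp
        finally have *: "norm (S y - cis (e * ln y) * w - Z + (cis (e * ln y) - cis (e * (ln N - ln n))) * w) \<le> 10 * real n / N" .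
        have "norm (?h n) = mangoldt n * (1 / n) * norm (S y - cis (e * ln y) * w - Z + (cis (e * ln y) - cis (e * (ln N - ln n))) * w)"
          unfolding norm_mult y_def[symmetric] by (simp add: f_def norm_divide)
        also have "\<dots> \<le> mangoldt n * (1 / n) * (10 * real n / N)"
          using * by (intro mult_left_mono mult_nonneg_nonneg) (auto simp: mangoldt_nonneg)
        also have "\<dots> = 10 * mangoldt n / N" using n by simp
        finally show "norm (?h n) \<le> 10 * mangoldt n / N" .
      qed
      also have "\<dots> = 10 / N * (\<Sum>n=1..N. mangoldt n)" by (simp add: sum_distrib_left)
      also have "\<dots> \<le> 10 / N * (4 * N)" using sum_mangoldt_le[of N] by (intro mult_left_mono) auto
      also have "\<dots> = 40" using N by simp
      finally show ?thesis .
    qed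
    have M0: "norm (L - M0) \<le> 4"
    proof -
      have "L - M0 = of_real (- ((\<Sum>n=1..N. mangoldt n / real n) - ln (real N)))"
        unfolding L_def M0_def by simp
      thus ?thesis using mertens_mangoldt[OF N] by (simp only: norm_of_real abs_minus_cancel)
    qed
    define R where "R = S N - c * w - Z"
    have R: "norm R \<le> 4" 
    proof -
      have "norm R \<le> 4 / real N" using S[OF N] by (simp add: R_def c_def)
      also have "\<dots> \<le> 4 / 1" using N by (intro divide_left_mono) auto
      finally show ?thesis by simp
    qed
    \<comment> \<open>The terms of order \<open>w\<^sup>2\<close> cancel, so that dividing by \<open>Z\<close>, which is of order \<open>w\<close>,
       leaves a bounded quantity.\<close>
    have "Z * (M - S N) = c * w * (L - M0) + (\<tau> - \<sigma>) - \<gamma> * c * w - \<gamma> ^ 2 + 2 * \<gamma> * w - Z * R"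
      unfolding \<tau>_def \<sigma>_def R_def \<gamma>_def by (simp add: algebra_simps power2_eq_square)
    also have "norm \<dots> \<le> norm (c * w * (L - M0)) + (norm \<tau> + norm \<sigma>) + norm (\<gamma> * c * w) 
        + norm (\<gamma> ^ 2) + norm (2 * \<gamma> * w) + norm (Z * R)"
      by (intro order.trans[OF norm_triangle_ineq4] order.trans[OF norm_triangle_ineq] add_mono order.refl)
    also have "\<dots> \<le> norm w * 4 + (C + 40) + 5 * norm w + 25 + 2 * 5 * norm w + (5 + norm w) * 4"
    proof -
      have "norm (c * w * (L - M0)) \<le> norm w * 4"
        using M0 by (simp add: norm_mult nc mult_left_mono)
      moreover have "norm (\<gamma> * c * w) \<le> 5 * norm w"
        using \<gamma> by (simp add: norm_mult nc mult_right_mono)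
      moreover have "norm (\<gamma> ^ 2) \<le> 5 ^ 2"
        using \<gamma> unfolding norm_power by (intro power_mono) auto
      moreover have "norm (2 * \<gamma> * w) \<le> 2 * 5 * norm w"
        unfolding norm_mult using \<gamma> by (intro mult_mono) auto
      moreover have "norm Z \<le> 5 + norm w"
        using \<gamma> norm_triangle_ineq4[of \<gamma> w] by (simp add: \<gamma>_def)
      hence "norm (Z * R) \<le> (5 + norm w) * 4"
        unfolding norm_mult using R by (intro mult_mono) auto
      ultimately show ?thesis using \<tau> \<sigma> by simp
    qed
    also have "\<dots> = C + 85 + 23 * norm w" by simp
    also have "\<dots> \<le> (C + 85) * norm w + 23 * norm w"
    proof -
      have "0 \<le> C" using \<tau> norm_ge_zero order.trans by blast
      hence "(C + 85) * 1 \<le> (C + 85) * norm w" using nw10 by (intro mult_left_mono) auto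
      thus ?thesis by simp
    qed
    finally have 1: "norm Z * norm (M - S N) \<le> (C + 108) * norm w"
      unfolding norm_mult by (simp add: distrib_right)
    have "norm w / 2 \<le> norm Z"
      using \<gamma> norm_triangle_ineq4[of \<gamma> Z] nw10 by (simp add: \<gamma>_def)
    hence "norm w / 2 * norm (M - S N) \<le> norm Z * norm (M - S N)" by (intro mult_right_mono) auto
    hence "norm w * norm (M - S N) \<le> norm w * (2 * (C + 108))" using 1 by (simp add: algebra_simps)
    hence "norm (M - S N) \<le> 2 * (C + 108)" using nw10 by (subst (asm) mult_le_cancel_left_pos) auto
    also have "M - S N = (\<Sum>n=1..N. (mangoldt n - 1) * f n)"
      by (simp add: M_def S_def sum_subtractf left_diff_distrib)
    finally show "norm (\<Sum>n=1..N. (mangoldt n - 1) * (cis (e * ln (real n)) / of_nat n)) \<le> 2 * (C + 108)"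
      by (simp only: f_def)
  qed
qed

section \<open>Summation by parts, prime powers and the exponential integral\<close>

text \<open>Abel summation; the weights enter through their last value and their total
  variation.\<close>

lemma summation_by_parts_bound:
  fixes a w :: "nat \<Rightarrow> 'a :: real_normed_algebra"
  assumes "m \<le> N" and B: "\<And>n. m \<le> n \<Longrightarrow> n \<le> N \<Longrightarrow> norm (\<Sum>j=m..n. a j) \<le> B"
  shows "norm (\<Sum>j=m..N. a j * w j) \<le> B * (norm (w N) + (\<Sum>j=m..<N. norm (w j - w (Suc j))))"
proof -
  define A where "A = (\<lambda>n. \<Sum>j=m..n. a j)"
  have "(\<Sum>j=m..N. a j * w j) = A N * w N + (\<Sum>j=m..<N. A j * (w j - w (Suc j)))"
    using assms(1) by (induction N rule: dec_induct) (auto simp: A_def algebra_simps)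
  also have "norm \<dots> \<le> norm (A N) * norm (w N) + (\<Sum>j=m..<N. norm (A j) * norm (w j - w (Suc j)))"
    by (intro norm_triangle_le add_mono norm_mult_ineq sum_norm_le)
  also have "\<dots> \<le> B * norm (w N) + (\<Sum>j=m..<N. B * norm (w j - w (Suc j)))"
    using B assms(1) by (intro add_mono sum_mono mult_right_mono) (auto simp: A_def)
  finally show ?thesis by (simp add: sum_distrib_left distrib_left)
qed

section \<open>The weight (exp(ieu) - 1) / u and its variation\<close>

lemma has_vector_derivative_cis_minus_1_over:
  assumes "u > 0"
  shows "((\<lambda>u. of_real (1 / u) * (cis (e * u) - 1)) has_vector_derivative
     (\<i> * e * u * cis (e * u) - (cis (e * u) - 1)) / u ^ 2) (at u)"
proof -
  have inv': "((\<lambda>u. complex_of_real (1 / u)) has_vector_derivative of_real (- 1 / u ^ 2)) (at u)"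
    using assms by (intro has_vector_derivative_of_real)
      (auto intro!: derivative_eq_intros simp flip: has_real_derivative_iff_has_vector_derivative
         simp: field_simps power2_eq_square)
  have cis': "((\<lambda>u. cis (e * u) - 1) has_vector_derivative (\<i> * e * cis (e * u))) (at u)"
    unfolding has_vector_derivative_def
    by (auto intro!: derivative_eq_intros simp: scaleR_conv_of_real)
  show ?thesis
    by (rule has_vector_derivative_eq_rhs[OF has_vector_derivative_mult[OF inv' cis']])
       (use assms in \<open>simp add: field_simps power2_eq_square\<close>)
qed

lemma norm_deriv_cis_minus_1_over_le:
  assumes "u > 0"
  shows "norm ((\<i> * e * u * cis (e * u) - (cis (e * u) - 1)) / complex_of_real u ^ 2) \<le> e ^ 2"
proof -
  define y where "y = e * u"
  \<comment> \<open>Factoring out \<open>cis y\<close> exposes the remainder of the exponential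
    series after its linear term. It is at most \<open>y ^ 2\<close>, so \<open>u\<close> cancels
    from the final bound.\<close>
  have "\<i> * e * u * cis (e * u) - (cis (e * u) - 1) = cis y * (exp (- (\<i> * y)) - (1 - \<i> * y))"
    unfolding y_def cis_conv_exp by (simp add: algebra_simps flip: exp_add)
  also have "norm \<dots> = norm (exp (- (\<i> * y)) - (1 - \<i> * y))"
    by (simp add: norm_mult)
  also have "\<dots> \<le> y ^ 2"
    using Taylor_exp[of "- (\<i> * y)" 1] by (simp add: norm_mult power2_eq_square)
  finally have "norm (\<i> * e * u * cis (e * u) - (cis (e * u) - 1)) / u ^ 2 \<le> y ^ 2 / u ^ 2"
    by (intro divide_right_mono) auto
  thus ?thesis using assms by (simp add: norm_divide norm_power y_def power_mult_distrib)
qed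

lemma norm_cis_minus_1_over_le:
  assumes "u > 0"
  shows "norm (of_real (1 / u) * (cis (e * u) - 1)) \<le> \<bar>e\<bar>"
proof -
  have "norm (of_real (1 / u) * (cis (e * u) - 1)) = norm (cis (e * u) - cis 0) / u"
    using assms by (simp add: norm_mult norm_divide)
  also have "\<dots> \<le> \<bar>e * u - 0\<bar> / u" using assms by (intro divide_right_mono norm_cis_diff_le) auto
  also have "\<dots> = \<bar>e\<bar>" using assms by (simp add: abs_mult)
  finally show ?thesis .
qed

text \<open>The mean value inequality. At the points \<open>u = ln n\<close> these differences
  telescope, which bounds the total variation by \<open>e ^ 2\<close> times the length of the
  logarithmic range.\<close>

lemma norm_cis_minus_1_over_diff_le:
  assumes "0 < u" "u \<le> v"
  shows "norm (of_real (1 / u) * (cis (e * u) - 1) - of_real (1 / v) * (cis (e * v) - 1)) \<le> e ^ 2 * (v - u)"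
proof -
  have "norm ((\<lambda>u. of_real (1 / u) * (cis (e * u) - 1)) u - 
              (\<lambda>u. of_real (1 / u) * (cis (e * u) - 1)) v) \<le> e ^ 2 * norm (u - v)"
  proof (rule differentiable_bound[of "{u..v}"])
    fix x assume x: "x \<in> {u..v}"
    hence x0: "x > 0" using assms by auto
    show "((\<lambda>u. of_real (1 / u) * (cis (e * u) - 1)) has_derivative 
            (\<lambda>h. h *\<^sub>R ((\<i> * e * x * cis (e * x) - (cis (e * x) - 1)) / complex_of_real x ^ 2))) (at x within {u..v})"
      using has_vector_derivative_cis_minus_1_over[OF x0, of e]
      by (simp add: has_vector_derivative_def has_derivative_at_withinI)
    show "onorm (\<lambda>h. h *\<^sub>R ((\<i> * e * x * cis (e * x) - (cis (e * x) - 1)) / complex_of_real x ^ 2)) \<le> e\<^sup>2"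
      using mult_left_mono[OF norm_deriv_cis_minus_1_over_le[OF x0, of e] abs_ge_zero]
      by (intro onorm_le) (simp add: mult.commute)
  qed (use assms in auto)
  thus ?thesis using assms by simp
qed

section \<open>The contribution of higher prime powers\<close>

text \<open>For each prime the geometric series over exponents from 2 on is at most
  \<open>2 / p ^ 2\<close>, because \<open>1 / p <= 1 / 2\<close>. With
  \<open>ln p <= 2 * sqrt p\<close> this leaves \<open>4 * p powr (-3/2)\<close>, which is
  summable.\<close>

lemma sum_mangoldt_nonprime_le:
  obtains C where "\<And>N. (\<Sum>n | n \<in> {1..N} \<and> \<not>prime n. mangoldt n / real n) \<le> C"
proof
  fix N :: nat
  define A where "A = {n \<in> {1..N}. \<not>prime n \<and> primepow n}"
  define B where "B = {p\<in>{2..N}. prime p} \<times> {2..N}"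
  have B: "finite B" by (auto simp: B_def)
  have sub: "A \<subseteq> (\<lambda>(p,k). p ^ k) ` B"
  proof
    fix n assume n: "n \<in> A"
    then obtain p k where pk: "prime p" "k > 0" "n = p ^ k" by (auto simp: A_def primepow_def)
    have "k \<noteq> 1" using pk n by (auto simp: A_def)
    have "p \<ge> 2" using pk prime_ge_2_nat by auto
    \<comment> \<open>This crude bound only serves to enclose the exponents in a finite
      range.\<close>
    have "k < 2 ^ k" by (rule less_exp)
    also have "2 ^ k \<le> p ^ k" using \<open>p \<ge> 2\<close> by (intro power_mono) auto
    also have "p ^ k \<le> N" using n pk by (auto simp: A_def)
    finally have "k \<le> N" by simp
    have "p ^ 1 \<le> p ^ k" using pk \<open>p \<ge> 2\<close> by (intro power_increasing) auto
    hence "p \<le> N" using \<open>p ^ k \<le> N\<close> by simp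
    hence "(p, k) \<in> B" using pk \<open>k \<le> N\<close> \<open>k \<noteq> 1\<close> \<open>p \<ge> 2\<close> by (auto simp: B_def)
    thus "n \<in> (\<lambda>(p,k). p ^ k) ` B" using pk by force
  qed
  have "(\<Sum>n | n \<in> {1..N} \<and> \<not>prime n. mangoldt n / real n) = (\<Sum>n\<in>A. mangoldt n / real n)"
    by (intro sum.mono_neutral_right) (auto simp: A_def mangoldt_def)
  also have "\<dots> \<le> (\<Sum>n\<in>(\<lambda>(p,k). p ^ k) ` B. mangoldt n / real n)"
    using B sub by (intro sum_mono2) (auto simp: mangoldt_nonneg)
  also have "\<dots> \<le> sum ((\<lambda>n. mangoldt n / real n) \<circ> (\<lambda>(p,k). p ^ k)) B"
    using B by (intro sum_image_le) (auto simp: mangoldt_nonneg)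
  also have "\<dots> = (\<Sum>(p,k)\<in>B. ln (real p) * (1 / real p) ^ k)"
    by (intro sum.cong) (auto simp: B_def power_divide)
  also have "\<dots> = (\<Sum>p | p \<in> {2..N} \<and> prime p. ln (real p) * (\<Sum>k=2..N. (1 / real p) ^ k))"
    unfolding B_def by (subst sum.cartesian_product[symmetric]) (simp add: sum_distrib_left)
  also have "\<dots> \<le> (\<Sum>p | p \<in> {2..N} \<and> prime p. 4 * real p powr (-3/2))"
  proof (intro sum_mono)
    fix p assume p: "p \<in> {p \<in> {2..N}. prime p}"
    hence p2: "real p \<ge> 2" by auto
    define x where "x = 1 / real p"
    have x: "0 < x" "x \<le> 1 / 2" using p2 by (auto simp: x_def field_simps)
    have "(\<Sum>k=2..N. x ^ k) * (1 - x) \<le> x ^ 2"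
      using sum_gp_multiplied[of 2 N x] x p by (auto simp: mult.commute)
    moreover have "(\<Sum>k=2..N. x ^ k) * (1 / 2) \<le> (\<Sum>k=2..N. x ^ k) * (1 - x)"
      using x by (intro mult_left_mono sum_nonneg) auto
    ultimately have "(\<Sum>k=2..N. x ^ k) \<le> 2 * x ^ 2" by linarith
    moreover have "ln (real p) \<le> 2 * sqrt p" using p2 ln_bound[of "sqrt p"] by (auto simp: ln_sqrt)
    ultimately have "ln (real p) * (\<Sum>k=2..N. x ^ k) \<le> 2 * sqrt p * (2 * x ^ 2)"
      using x p2 by (intro mult_mono sum_nonneg) auto
    also have "\<dots> = 4 * (sqrt p / real p ^ 2)" by (simp add: x_def power_divide)
    also have "sqrt p / real p ^ 2 = real p powr (-3/2)"
      using p2 by (simp add: powr_half_sqrt [symmetric] powr_diff [symmetric] flip: powr_numeral)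
    finally show "ln (real p) * (\<Sum>k=2..N. (1 / real p) ^ k) \<le> 4 * real p powr (-3/2)" by (simp add: x_def)
  qed
  also have "\<dots> \<le> (\<Sum>p. 4 * real p powr (-3/2))"
    by (intro sum_le_suminf summable_mult) (auto simp: summable_real_powr_iff)
  finally show "(\<Sum>n | n \<in> {1..N} \<and> \<not>prime n. mangoldt n / real n) \<le> (\<Sum>p. 4 * real p powr (-3/2))" .
qed

section \<open>The entire exponential integral\<close>

text \<open>The value 1 fills the removable singularity at 0.\<close>

definition ein_deriv :: "complex \<Rightarrow> complex" where
  "ein_deriv z = (if z = 0 then 1 else (exp z - 1) / z)"

lemma continuous_on_ein_deriv: "continuous_on A ein_deriv"
proof -
  have "isCont ein_deriv z" for z
  proof (cases "z = 0")
    case True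
    have "(\<lambda>h. (exp (0 + h) - exp 0) / h) \<midarrow>0\<rightarrow> (exp 0 :: complex)"
      using DERIV_exp[of 0] unfolding DERIV_def .
    hence "((\<lambda>h. (exp h - 1) / h) \<longlongrightarrow> (1 :: complex)) (at 0)" by simp
    hence "(ein_deriv \<longlongrightarrow> 1) (at 0)"
      by (rule Lim_transform_eventually) (auto simp: eventually_at_filter ein_deriv_def)
    thus ?thesis using True by (simp add: isCont_def ein_deriv_def)
  next
    case False
    have "isCont (\<lambda>z. (exp z - 1) / z) z" using False by (intro continuous_intros) auto
    also have "?this \<longleftrightarrow> ?thesis"
      using False by (intro isCont_cong eventually_mono[OF t1_space_nhds]) (auto simp: ein_deriv_def)
    finally show ?thesis .
  qed
  thus ?thesis by (simp add: continuous_at_imp_continuous_on)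
qed

text \<open>The choice fixes \<open>ein\<close> only up to an additive constant, so it occurs in
  differences \<open>ein z - ein 0\<close>. These equal -Ein(-z) for the classical entire function
  Ein.\<close>

definition ein :: "complex \<Rightarrow> complex" where
  "ein = (SOME G. \<forall>z. (G has_field_derivative ein_deriv z) (at z))"

lemma has_field_derivative_ein: "(ein has_field_derivative ein_deriv z) (at z)"
proof -
  have "\<exists>G. \<forall>z. (G has_field_derivative ein_deriv z) (at z)"
  \<comment> \<open>The existence theorem for primitives on convex sets admits the exceptional point
    0, where continuity is enough.\<close>
  proof (rule holomorphic_convex_primitive[of UNIV "{0}" ein_deriv])
    fix z :: complex assume "z \<in> interior UNIV - {0}"
    hence z: "z \<noteq> 0" by auto
    have "(\<lambda>z. (exp z - 1) / z) field_differentiable at z"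
      using z by (intro derivative_intros field_differentiable_within_exp) auto
    thus "ein_deriv field_differentiable at z"
      by (rule field_differentiable_transform_within[of "norm z", rotated 3])
         (use z in \<open>auto simp: ein_deriv_def\<close>)
  qed (auto simp: continuous_on_ein_deriv)
  from someI_ex[OF this] show ?thesis by (simp add: ein_def)
qed

text \<open>Along the segment z = itv the chain rule produces the integrand of
  \<open>phi_limit\<close>, except possibly at \<open>v = 0\<close>, a single point that the
  integral ignores.\<close>

lemma phi_limit_eq_ein: "phi_limit \<alpha> t = exp (\<alpha> * (ein (\<i> * t) - ein 0))"
proof -
  have "((\<lambda>v. \<i> * t * ein_deriv (\<i> * t * of_real v)) has_integral 
          (ein (\<i> * t * of_real 1) - ein (\<i> * t * of_real 0))) {0..1}"
  proof (rule fundamental_theorem_of_calculus)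
    fix v :: real
    have "((\<lambda>z. ein (\<i> * t * z)) has_field_derivative (\<i> * t * ein_deriv (\<i> * t * of_real v))) (at (of_real v))"
      by (rule DERIV_chain2[OF has_field_derivative_ein, THEN DERIV_cong])
         (auto intro!: derivative_eq_intros)
    from has_vector_derivative_real_field[OF this]
    show "((\<lambda>v. ein (\<i> * t * of_real v)) has_vector_derivative (\<i> * t * ein_deriv (\<i> * t * of_real v)))
            (at v within {0..1})" .
  qed auto
  hence "((\<lambda>v. \<i> * t * ein_deriv (\<i> * t * of_real v)) has_integral (ein (\<i> * t) - ein 0)) {0..1}"
    by simp
  hence "((\<lambda>v. (exp (\<i> * of_real (t * v)) - 1) / of_real v) has_integral (ein (\<i> * t) - ein 0)) {0..1}"
    by (rule has_integral_spike_finite[of "{0}", rotated 2])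
       (auto simp: ein_deriv_def mult.assoc)
  thus ?thesis unfolding phi_limit_def by (simp add: integral_unique)
qed

section \<open>The exponential sum over primes\<close>

text \<open>Mertens contributes 4, and \<open>harm N - ln N\<close>, which decreases from 1 and
  stays nonnegative, contributes 1.\<close>

lemma sum_mangoldt_minus_one_le:
  assumes "N \<ge> 1"
  shows "norm (\<Sum>n=1..N. (mangoldt n - 1) / of_nat n :: complex) \<le> 5"
proof -
  have "\<bar>harm N - ln (real N)\<bar> \<le> 1"
  proof -
    have "harm (Suc (N - 1)) - ln (real (Suc (N - 1))) \<le> harm (Suc 0) - ln (real (Suc 0))"
      using decseqD[OF decseq_harm_diff_ln, of 0 "N - 1"] by simp
    moreover have "0 \<le> harm N - ln (real N)"
      using euler_mascheroni_sequence_nonneg[of N] assms by simp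
    ultimately show ?thesis using assms by (simp add: harm_expand)
  qed
  hence "\<bar>(\<Sum>n=1..N. mangoldt n / real n) - harm N\<bar> \<le> 5"
    using mertens_mangoldt[OF assms] by linarith
  also have "(\<Sum>n=1..N. mangoldt n / real n) - harm N = (\<Sum>n=1..N. (mangoldt n - 1) / real n)"
    by (simp add: harm_def sum_subtractf diff_divide_distrib inverse_eq_divide)
  also have "\<bar>\<dots>\<bar> = norm (\<Sum>n=1..N. (mangoldt n - 1) / of_nat n :: complex)"
  proof -
    have "(\<Sum>n=1..N. (mangoldt n - 1) / of_nat n :: complex) = of_real (\<Sum>n=1..N. (mangoldt n - 1) / real n)"
      by simp
    thus ?thesis by (simp only: norm_of_real)
  qed
  finally show ?thesis .
qed

lemma norm_sum_atLeastAtMost_le: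
  fixes a :: "nat \<Rightarrow> 'a :: real_normed_vector"
  assumes "\<And>n. 1 \<le> n \<Longrightarrow> n \<le> N \<Longrightarrow> norm (\<Sum>j=1..n. a j) \<le> B" "2 \<le> m" "m \<le> n" "n \<le> N"
  shows "norm (\<Sum>j=m..n. a j) \<le> 2 * B"
proof -
  have "{1..n} = {1..m-1} \<union> {m..n}" using assms by auto
  hence "(\<Sum>j=1..n. a j) = (\<Sum>j=1..m-1. a j) + (\<Sum>j=m..n. a j)"
    by (simp only:) (rule sum.union_disjoint, auto)
  hence "(\<Sum>j=m..n. a j) = (\<Sum>j=1..n. a j) - (\<Sum>j=1..m-1. a j)" by simp
  also have "norm \<dots> \<le> B + B"
    using assms by (intro order.trans[OF norm_triangle_ineq4] add_mono) auto
  finally show ?thesis by simp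
qed

text \<open>This replaces \<open>mangoldt n\<close> by 1 in the weighted sum. The error is
  proportional to |e|, not merely bounded, as the final relative error requires.\<close>

lemma sum_mangoldt_minus_one_cis:
  obtains C where "\<And>e N. e \<noteq> 0 \<Longrightarrow> \<bar>e\<bar> \<le> 1/10 \<Longrightarrow> N \<ge> 2 \<Longrightarrow>
     norm (\<Sum>n=2..N. (mangoldt n - 1) / of_nat n * 
        (of_real (1 / ln (real n)) * (cis (e * ln (real n)) - 1))) \<le> C * \<bar>e\<bar>"
proof -
  obtain C where C: "\<And>e N. e \<noteq> 0 \<Longrightarrow> \<bar>e\<bar> \<le> 1/10 \<Longrightarrow> N \<ge> 1 \<Longrightarrow>
     norm (\<Sum>n=1..N. (mangoldt n - 1) * (cis (e * ln (real n)) / of_nat n)) \<le> C"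
    by (rule twisted_mangoldt_sum) blast
  define b where "b = (\<lambda>n. (mangoldt n - 1) / of_nat n :: complex)"
  show ?thesis
  proof (rule that)
    fix e :: real and N :: nat
    assume e: "e \<noteq> 0" "\<bar>e\<bar> \<le> 1/10" and N: "N \<ge> 2"
    define h where "h = (\<lambda>n. of_real (1 / ln (real n)) * (cis (e * ln (real n)) - 1))"
    have C0: "0 \<le> C" using C[OF e, of 1] norm_ge_zero order.trans by blast
    \<comment> \<open>Below \<open>exp (1 / \<bar>e\<bar>)\<close> the untwisted sums suffice, since \<open>h\<close> has total variation \<open>O(e)\<close>
       there; above it the weights \<open>1 / ln n \<le> \<bar>e\<bar>\<close> are summed against the bounded twisted sums.\<close>
    have low: "norm (\<Sum>n=2..K. b n * h n) \<le> 20 * \<bar>e\<bar>" if K: "K \<ge> 2" "ln (real K) \<le> 1 / \<bar>e\<bar>" for K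
    proof -
      \<comment> \<open>The factor 2 appears because the partial sums start at 2 and are differences
        of two initial sums.\<close>
      have "norm (\<Sum>n=2..K. b n * h n) \<le> (2 * 5) * (norm (h K) + (\<Sum>j=2..<K. norm (h j - h (Suc j))))"
      proof (rule summation_by_parts_bound)
        fix n assume "2 \<le> n" "n \<le> K"
        thus "norm (\<Sum>j=2..n. b j) \<le> 2 * 5"
          unfolding b_def by (intro norm_sum_atLeastAtMost_le[of K] sum_mangoldt_minus_one_le) auto
      qed (use K in auto)
      also have "norm (h K) \<le> \<bar>e\<bar>"
        unfolding h_def using K by (intro norm_cis_minus_1_over_le) auto
      also have "(\<Sum>j=2..<K. norm (h j - h (Suc j))) \<le> (\<Sum>j=2..<K. e ^ 2 * (ln (real (Suc j)) - ln (real j)))"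
        unfolding h_def by (intro sum_mono norm_cis_minus_1_over_diff_le) auto
      also have "\<dots> = e ^ 2 * (ln (real K) - ln 2)"
        unfolding sum_distrib_left[symmetric] using K by (subst sum_Suc_diff') auto
      also have "\<dots> \<le> e ^ 2 * (1 / \<bar>e\<bar>)" 
      proof (rule mult_left_mono)
        have "ln (2 :: real) > 0" by simp
        thus "ln (real K) - ln 2 \<le> 1 / \<bar>e\<bar>" using K by linarith
      qed auto
      also have "\<dots> = \<bar>e\<bar>" using e by (simp add: power2_eq_square abs_if)
      finally show ?thesis by simp
    qed
    have high: "norm (\<Sum>n=Suc K..N. b n * h n) \<le> (2 * (C + 5)) * \<bar>e\<bar>" 
      if K: "K \<ge> 2" "K < N" "1 / \<bar>e\<bar> \<le> ln (real (Suc K))" for K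
    proof -
      \<comment> \<open>The oscillating factor moves from the weight into the summand. The remaining
        weight \<open>1 / ln n\<close> is decreasing, so its variation and last value add up to
        \<open>1 / ln (Suc K)\<close>, at most |e|.\<close>
      have "(\<Sum>n=Suc K..N. b n * h n) = (\<Sum>n=Suc K..N. (b n * (cis (e * ln (real n)) - 1)) * of_real (1 / ln (real n)))"
        by (intro sum.cong) (auto simp: h_def)
      also have "norm \<dots> \<le> (2 * (C + 5)) * (norm (complex_of_real (1 / ln (real N))) +
           (\<Sum>j=Suc K..<N. norm (complex_of_real (1 / ln (real j)) - of_real (1 / ln (real (Suc j))))))"
      proof (rule summation_by_parts_bound)
        fix n assume n: "Suc K \<le> n" "n \<le> N"
        show "norm (\<Sum>j=Suc K..n. b j * (cis (e * ln (real j)) - 1)) \<le> 2 * (C + 5)"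
        proof (rule norm_sum_atLeastAtMost_le)
          fix n :: nat assume n: "1 \<le> n"
          have "(\<Sum>j=1..n. b j * (cis (e * ln (real j)) - 1)) = 
             (\<Sum>n=1..n. (mangoldt n - 1) * (cis (e * ln (real n)) / of_nat n)) - (\<Sum>j=1..n. b j)"
            by (simp add: b_def algebra_simps sum_subtractf)
          also have "norm \<dots> \<le> C + 5"
            using C[OF e n] sum_mangoldt_minus_one_le[OF n]
            by (intro order.trans[OF norm_triangle_ineq4] add_mono) (auto simp: b_def)
          finally show "norm (\<Sum>j=1..n. b j * (cis (e * ln (real j)) - 1)) \<le> C + 5" .
        qed (use n K in auto)
      qed (use K in auto)
      also have "norm (complex_of_real (1 / ln (real N))) = 1 / ln (real N)"
        unfolding norm_of_real using K by simp
      also have "(\<Sum>j=Suc K..<N. norm (complex_of_real (1 / ln (real j)) - of_real (1 / ln (real (Suc j))))) =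
                 (\<Sum>j=Suc K..<N. - (1 / ln (real (Suc j))) - - (1 / ln (real j)))"
      proof (intro sum.cong refl)
        fix j assume j: "j \<in> {Suc K..<N}"
        have "1 / ln (real (Suc j)) \<le> 1 / ln (real j)"
          using j K by (intro divide_left_mono mult_pos_pos) auto
        thus "norm (complex_of_real (1 / ln (real j)) - of_real (1 / ln (real (Suc j)))) = - (1 / ln (real (Suc j))) - - (1 / ln (real j))"
          unfolding of_real_diff[symmetric] norm_of_real by simp
      qed
      also have "\<dots> = 1 / ln (real (Suc K)) - 1 / ln (real N)"
        using K by (subst sum_Suc_diff') auto
      also have "1 / ln (real N) + (1 / ln (real (Suc K)) - 1 / ln (real N)) = 1 / ln (real (Suc K))" by simp
      also have "\<dots> \<le> 1 / (1 / \<bar>e\<bar>)"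
        using K e by (intro divide_left_mono mult_pos_pos) auto
      also have "\<dots> = \<bar>e\<bar>" by simp
      finally show ?thesis using C0 by (simp add: mult_left_mono)
    qed
    have "norm (\<Sum>n=2..N. b n * h n) \<le> (2 * C + 30) * \<bar>e\<bar>"
    proof (cases "ln (real N) \<le> 1 / \<bar>e\<bar>")
      case True
      from low[OF N this] have "norm (\<Sum>n=2..N. b n * h n) \<le> 20 * \<bar>e\<bar>" .
      also have "\<dots> \<le> (2 * C + 30) * \<bar>e\<bar>" using C0 by (intro mult_right_mono) auto
      finally show ?thesis .
    next
      case False
      \<comment> \<open>\<open>K\<close> is the last integer up to exp(1/|e|). Small |e| guarantees
        \<open>K >= 2\<close>, hence positive logarithms.\<close>
      define K where "K = nat \<lfloor>exp (1 / \<bar>e\<bar>)\<rfloor>"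
      have "2 \<le> 1 + 1 / \<bar>e\<bar>" using e by (simp add: field_simps)
      also have "\<dots> \<le> exp (1 / \<bar>e\<bar>)" by (rule exp_ge_add_one_self)
      finally have e2: "exp (1 / \<bar>e\<bar>) \<ge> 2" .
      have K: "K \<ge> 2" "real K \<le> exp (1 / \<bar>e\<bar>)" "exp (1 / \<bar>e\<bar>) \<le> real (Suc K)"
        unfolding K_def using e2 by linarith+
      have "ln (real K) \<le> ln (exp (1 / \<bar>e\<bar>))" using K by (subst ln_le_cancel_iff) auto
      hence K1: "ln (real K) \<le> 1 / \<bar>e\<bar>" by simp
      have "ln (exp (1 / \<bar>e\<bar>)) \<le> ln (real (Suc K))" using K by (subst ln_le_cancel_iff) auto
      hence K2: "1 / \<bar>e\<bar> \<le> ln (real (Suc K))" by simp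
      have "K < N"
      proof (rule ccontr)
        assume "\<not> K < N"
        hence "ln (real N) \<le> ln (real K)" using N by (subst ln_le_cancel_iff) auto
        thus False using K1 False by simp
      qed
      have "{2..N} = {2..K} \<union> {Suc K..N}" using K \<open>K < N\<close> by auto
      hence "(\<Sum>n=2..N. b n * h n) = (\<Sum>n=2..K. b n * h n) + (\<Sum>n=Suc K..N. b n * h n)"
        by (simp only:) (rule sum.union_disjoint, auto)
      also have "norm \<dots> \<le> 20 * \<bar>e\<bar> + (2 * (C + 5)) * \<bar>e\<bar>"
        using low[OF K(1) K1] high[OF K(1) \<open>K < N\<close> K2] by (intro norm_triangle_le add_mono)
      finally show ?thesis by (simp add: algebra_simps)
    qed
    thus "norm (\<Sum>n=2..N. (mangoldt n - 1) / of_nat n * 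
        (of_real (1 / ln (real n)) * (cis (e * ln (real n)) - 1))) \<le> (2 * C + 30) * \<bar>e\<bar>"
      by (simp only: b_def h_def)
  qed
qed

text \<open>Under \<open>u = ln t\<close> the summand integrates to the integral of (exp(ieu) - 1) /
  u, with primitive ein(ieu). Its derivative in \<open>t\<close> is O(|e| / t^2), so all step errors
  together are O(|e|).\<close>

lemma sum_cis_minus_1_over_log:
  obtains C where "\<And>e N. e \<noteq> 0 \<Longrightarrow> \<bar>e\<bar> \<le> 1 \<Longrightarrow> N \<ge> 2 \<Longrightarrow>
     norm ((\<Sum>n=2..N. (of_real (1 / ln (real n)) * (cis (e * ln (real n)) - 1)) / of_nat n)
       - (ein (\<i> * of_real (e * ln (real N))) - ein 0)) \<le> C * \<bar>e\<bar>"
proof -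
  have "compact (ein_deriv ` cball 0 1)"
    by (intro compact_continuous_image continuous_on_ein_deriv) auto
  then obtain B where B: "\<And>z. norm z \<le> 1 \<Longrightarrow> norm (ein_deriv z) \<le> B"
    by (force simp: bounded_iff dest!: compact_imp_bounded)
  define D where "D = (\<Sum>n. 2 / real n ^ 2)"
  show ?thesis
  proof (rule that)
    fix e :: real and N :: nat
    assume e: "e \<noteq> 0" "\<bar>e\<bar> \<le> 1" and N: "N \<ge> 2"
    define h where "h = (\<lambda>u. complex_of_real (1 / u) * (cis (e * u) - 1))"
    define h' where "h' = (\<lambda>u. (\<i> * e * u * cis (e * u) - (cis (e * u) - 1)) / complex_of_real u ^ 2)"
    define f where "f = (\<lambda>t. of_real (1 / t) * h (ln t))"
    define F where "F = (\<lambda>t. ein (\<i> * of_real (e * ln t)))"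
    have d: "norm (f (real n + 1) - (F (real n + 1) - F (real n))) \<le> \<bar>e\<bar> * (2 / real n ^ 2)"
      if n: "n \<ge> 2" for n :: nat
    proof (rule primitive_step_bound)
      fix t assume t: "t \<in> {real n..real n + 1}"
      hence t0: "t > 0" "t > 1" "ln t > 0" using n by auto
      have ln': "(ln has_vector_derivative 1 / t) (at t)"
        using t0 by (auto intro!: derivative_eq_intros simp flip: has_real_derivative_iff_has_vector_derivative)
      have arg': "((\<lambda>t. \<i> * of_real (e * ln t)) has_vector_derivative (\<i> * of_real (e * (1 / t)))) (at t)"
        using t0 by (intro has_vector_derivative_mult_right has_vector_derivative_of_real)
          (auto intro!: derivative_eq_intros simp flip: has_real_derivative_iff_has_vector_derivative)
      have "((ein \<circ> (\<lambda>t. \<i> * of_real (e * ln t))) has_vector_derivative 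
              (\<i> * of_real (e * (1 / t)) * ein_deriv (\<i> * of_real (e * ln t)))) (at t)"
        by (rule field_vector_diff_chain_at[OF arg' has_field_derivative_ein])
      moreover have "\<i> * of_real (e * (1 / t)) * ein_deriv (\<i> * of_real (e * ln t)) = f t"
        using t0 e by (simp add: ein_deriv_def f_def h_def cis_conv_exp)
      ultimately show "(F has_vector_derivative f t) (at t)" by (simp add: F_def o_def)
      have inv': "((\<lambda>t. complex_of_real (1 / t)) has_vector_derivative of_real (- 1 / t ^ 2)) (at t)"
        using t0 by (intro has_vector_derivative_of_real)
          (auto intro!: derivative_eq_intros simp flip: has_real_derivative_iff_has_vector_derivative
             simp: field_simps power2_eq_square)
      have hln: "((h \<circ> ln) has_vector_derivative ((1 / t) *\<^sub>R h' (ln t))) (at t)"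
        unfolding h_def h'_def
        by (rule vector_diff_chain_at[OF ln' has_vector_derivative_cis_minus_1_over]) (use t0 in auto)
      show "(f has_vector_derivative (of_real (1 / t) * ((1 / t) *\<^sub>R h' (ln t)) + of_real (- 1 / t ^ 2) * h (ln t))) (at t)"
        using has_vector_derivative_mult[OF inv' hln] by (simp add: f_def o_def)
      have "norm (of_real (1 / t) * ((1 / t) *\<^sub>R h' (ln t)) + of_real (- 1 / t ^ 2) * h (ln t))
              \<le> 1 / t ^ 2 * norm (h' (ln t)) + 1 / t ^ 2 * norm (h (ln t))"
        using t0 by (intro norm_triangle_le add_mono)
          (auto simp: norm_mult norm_divide norm_power power2_eq_square divide_simps)
      also have "\<dots> \<le> 1 / t ^ 2 * \<bar>e\<bar> + 1 / t ^ 2 * \<bar>e\<bar>"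
      proof (intro add_mono mult_left_mono)
        have "norm (h' (ln t)) \<le> e ^ 2"
          unfolding h'_def using t0 by (intro norm_deriv_cis_minus_1_over_le)
        also have "e ^ 2 = \<bar>e\<bar> * \<bar>e\<bar>" by (simp add: power2_eq_square)
        also have "\<dots> \<le> \<bar>e\<bar> * 1" by (intro mult_left_mono) (use e in auto)
        also have "\<dots> = \<bar>e\<bar>" by simp
        finally show "norm (h' (ln t)) \<le> \<bar>e\<bar>" .
        show "norm (h (ln t)) \<le> \<bar>e\<bar>" unfolding h_def using t0 by (intro norm_cis_minus_1_over_le)
      qed auto
      also have "\<dots> = \<bar>e\<bar> * (2 / t ^ 2)" by simp
      also have "\<dots> \<le> \<bar>e\<bar> * (2 / real n ^ 2)"
        using t n by (intro mult_left_mono divide_left_mono power_mono mult_pos_pos) auto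
      finally show "norm (of_real (1 / t) * ((1 / t) *\<^sub>R h' (ln t)) + of_real (- 1 / t ^ 2) * h (ln t)) \<le> \<bar>e\<bar> * (2 / real n ^ 2)" .
    qed
    have "(\<Sum>n=2..N. (of_real (1 / ln (real n)) * (cis (e * ln (real n)) - 1)) / of_nat n) = (\<Sum>n=2..N. f (real n))"
      by (simp add: f_def h_def mult_ac)
    \<comment> \<open>The sum starts at 2, the target at \<open>ln t = 0\<close>. The term
      \<open>F 2 - ein 0\<close> accounts for the stretch from 1 to 2 and is O(|e|) because
      \<open>ein_deriv\<close> is bounded on the unit disc.\<close>
    also have "\<dots> - (F N - ein 0) = f 2 - (F 2 - ein 0) + (\<Sum>j=2..<N. f (real j + 1) - (F (real j + 1) - F (real j)))"
      using sum_eq_primitive[OF N, of f F] by simp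
    also have "norm \<dots> \<le> norm (f 2) + norm (F 2 - ein 0) + 
        norm (\<Sum>j=2..<N. f (real j + 1) - (F (real j + 1) - F (real j)))"
      by (rule norm_triangle_le[OF add_right_mono[OF norm_triangle_ineq4]])
    also have "\<dots> \<le> \<bar>e\<bar> + B * \<bar>e\<bar> + (\<Sum>j=2..<N. \<bar>e\<bar> * (2 / real j ^ 2))"
    proof (intro add_mono sum_norm_le d)
      have "norm (f 2) = 1 / 2 * norm (h (ln 2))" by (simp add: f_def norm_mult)
      also have "\<dots> \<le> 1 / 2 * \<bar>e\<bar>" unfolding h_def by (intro mult_left_mono norm_cis_minus_1_over_le) auto
      finally show "norm (f 2) \<le> \<bar>e\<bar>" by linarith
      have el: "\<bar>e * ln 2\<bar> \<le> \<bar>e\<bar> * 1"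
        unfolding abs_mult using ln_2_less_1 by (intro mult_left_mono) auto
      have elB: "\<bar>e\<bar> * ln 2 \<le> 1" using mult_mono[of "\<bar>e\<bar>" 1 "ln 2" 1] e ln_2_less_1 by simp
      have "norm (ein (\<i> * of_real (e * ln 2)) - ein 0) \<le> B * norm (\<i> * of_real (e * ln 2) - 0)"
        by (rule field_differentiable_bound[of "cball 0 1"])
           (use B elB in \<open>auto simp: norm_mult intro: has_field_derivative_ein[THEN has_field_derivative_at_within]\<close>)
      also have "\<dots> \<le> B * \<bar>e\<bar>"
        using el B[of 0] by (intro mult_left_mono) (auto simp: norm_mult abs_mult ein_deriv_def intro: order.trans[OF zero_le_one])
      finally show "norm (F 2 - ein 0) \<le> B * \<bar>e\<bar>" by (simp add: F_def)
    qed auto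
    also have "(\<Sum>j=2..<N. \<bar>e\<bar> * (2 / real j ^ 2)) \<le> \<bar>e\<bar> * D"
      unfolding sum_distrib_left[symmetric] D_def
      using summable_mult[OF inverse_power_summable[of 2, where ?'a = real], of 2]
      by (intro mult_left_mono sum_le_suminf) (auto simp: divide_inverse)
    finally show "norm ((\<Sum>n=2..N. (of_real (1 / ln (real n)) * (cis (e * ln (real n)) - 1)) / of_nat n)
       - (ein (\<i> * of_real (e * ln (real N))) - ein 0)) \<le> (1 + B + D) * \<bar>e\<bar>"
      by (simp add: F_def algebra_simps)
  qed
qed

text \<open>At a prime, \<open>mangoldt p / ln p\<close> is 1, so the prime sum is a
  \<open>mangoldt\<close> sum without its prime powers. \<open>C1\<close> pays for replacing
  \<open>mangoldt\<close> by 1, \<open>C2\<close> for passing to the integral, \<open>C3\<close> for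
  the prime powers.\<close>

lemma sum_primes_cis_minus_1:
  obtains C where "\<And>e N. e \<noteq> 0 \<Longrightarrow> \<bar>e\<bar> \<le> 1/10 \<Longrightarrow> N \<ge> 2 \<Longrightarrow>
     norm ((\<Sum>p | prime p \<and> p \<le> N. (cis (e * ln (real p)) - 1) / of_nat p)
       - (ein (\<i> * of_real (e * ln (real N))) - ein 0)) \<le> C * \<bar>e\<bar>"
proof -
  obtain C1 where C1: "\<And>e N. e \<noteq> 0 \<Longrightarrow> \<bar>e\<bar> \<le> 1/10 \<Longrightarrow> N \<ge> 2 \<Longrightarrow>
     norm (\<Sum>n=2..N. (mangoldt n - 1) / of_nat n * 
        (of_real (1 / ln (real n)) * (cis (e * ln (real n)) - 1))) \<le> C1 * \<bar>e\<bar>"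
    by (rule sum_mangoldt_minus_one_cis) blast
  obtain C2 where C2: "\<And>e N. e \<noteq> 0 \<Longrightarrow> \<bar>e\<bar> \<le> 1 \<Longrightarrow> N \<ge> 2 \<Longrightarrow>
     norm ((\<Sum>n=2..N. (of_real (1 / ln (real n)) * (cis (e * ln (real n)) - 1)) / of_nat n)
       - (ein (\<i> * of_real (e * ln (real N))) - ein 0)) \<le> C2 * \<bar>e\<bar>"
    by (rule sum_cis_minus_1_over_log) blast
  obtain C3 where C3: "\<And>N. (\<Sum>n | n \<in> {1..N} \<and> \<not>prime n. mangoldt n / real n) \<le> C3"
    by (rule sum_mangoldt_nonprime_le) blast
  show ?thesis
  proof (rule that)
    fix e :: real and N :: nat
    assume e: "e \<noteq> 0" "\<bar>e\<bar> \<le> 1/10" and N: "N \<ge> 2"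
    define h where "h = (\<lambda>n. of_real (1 / ln (real n)) * (cis (e * ln (real n)) - 1))"
    have tri: "norm (a + b - c) \<le> norm a + norm b + norm c" for a b c :: complex
      using norm_triangle_ineq4[of "a + b" c] norm_triangle_ineq[of a b] by linarith
    have diff: "(\<Sum>n=2..N. (mangoldt n - 1) / of_nat n * h n) =
        (\<Sum>n=2..N. mangoldt n / of_nat n * h n) - (\<Sum>n=2..N. h n / of_nat n)"
      unfolding sum_subtractf[symmetric]
      by (intro sum.cong refl) (simp add: diff_divide_distrib left_diff_distrib)
    have "(\<Sum>n=2..N. mangoldt n / of_nat n * h n) = 
      (\<Sum>n | n \<in> {2..N} \<and> prime n. mangoldt n / of_nat n * h n) +
      (\<Sum>n | n \<in> {2..N} \<and> \<not>prime n. mangoldt n / of_nat n * h n)"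
      by (subst sum.union_disjoint[symmetric]) (auto intro!: sum.cong)
    also have "(\<Sum>n | n \<in> {2..N} \<and> prime n. mangoldt n / of_nat n * h n) = 
        (\<Sum>p | prime p \<and> p \<le> N. (cis (e * ln (real p)) - 1) / of_nat p)"
    proof (rule sum.cong)
      fix p assume "p \<in> {p. prime p \<and> p \<le> N}"
      hence p: "prime p" "p > 1" using prime_gt_1_nat by auto
      hence "ln (real p) > 0" by simp
      thus "mangoldt p / of_nat p * h p = (cis (e * ln (real p)) - 1) / of_nat p"
        using p by (simp add: h_def)
    qed (auto intro: prime_ge_2_nat)
    finally have eq: "(\<Sum>p | prime p \<and> p \<le> N. (cis (e * ln (real p)) - 1) / of_nat p)
        - (ein (\<i> * of_real (e * ln (real N))) - ein 0) = 
      (\<Sum>n=2..N. (mangoldt n - 1) / of_nat n * h n) 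
      + ((\<Sum>n=2..N. h n / of_nat n) - (ein (\<i> * of_real (e * ln (real N))) - ein 0))
      - (\<Sum>n | n \<in> {2..N} \<and> \<not>prime n. mangoldt n / of_nat n * h n)"
      unfolding diff by simp
    have "norm ((\<Sum>p | prime p \<and> p \<le> N. (cis (e * ln (real p)) - 1) / of_nat p)
        - (ein (\<i> * of_real (e * ln (real N))) - ein 0))
      \<le> norm (\<Sum>n=2..N. (mangoldt n - 1) / of_nat n * h n) 
        + norm ((\<Sum>n=2..N. h n / of_nat n) - (ein (\<i> * of_real (e * ln (real N))) - ein 0))
        + norm (\<Sum>n | n \<in> {2..N} \<and> \<not>prime n. mangoldt n / of_nat n * h n)"
      unfolding eq by (rule tri)
    also have "\<dots> \<le> C1 * \<bar>e\<bar> + C2 * \<bar>e\<bar> + C3 * \<bar>e\<bar>"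
    proof (intro add_mono)
      have "norm (\<Sum>n | n \<in> {2..N} \<and> \<not>prime n. mangoldt n / of_nat n * h n) \<le> 
            (\<Sum>n | n \<in> {2..N} \<and> \<not>prime n. mangoldt n / real n * \<bar>e\<bar>)"
      proof (intro sum_norm_le)
        fix n assume "n \<in> {n \<in> {2..N}. \<not> prime n}"
        hence "norm (h n) \<le> \<bar>e\<bar>" unfolding h_def by (intro norm_cis_minus_1_over_le) auto
        thus "norm (mangoldt n / of_nat n * h n) \<le> mangoldt n / real n * \<bar>e\<bar>"
          unfolding norm_mult norm_divide norm_mangoldt norm_of_nat
          by (intro mult_left_mono) (auto simp: mangoldt_nonneg)
      qed
      also have "\<dots> \<le> (\<Sum>n | n \<in> {1..N} \<and> \<not>prime n. mangoldt n / real n * \<bar>e\<bar>)"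
        by (intro sum_mono2) (auto simp: mangoldt_nonneg)
      also have "\<dots> \<le> C3 * \<bar>e\<bar>"
        unfolding sum_distrib_right[symmetric] by (intro mult_right_mono C3) auto
      finally show "norm (\<Sum>n | n \<in> {2..N} \<and> \<not>prime n. mangoldt n / of_nat n * h n) \<le> C3 * \<bar>e\<bar>" .
      show "norm (\<Sum>n=2..N. (mangoldt n - 1) / of_nat n * h n) \<le> C1 * \<bar>e\<bar>"
        unfolding h_def by (rule C1[OF e N])
      show "norm ((\<Sum>n=2..N. h n / of_nat n) - (ein (\<i> * of_real (e * ln (real N))) - ein 0)) \<le> C2 * \<bar>e\<bar>"
        unfolding h_def by (rule C2) (use e N in auto)
    qed
    also have "\<dots> = (C1 + C2 + C3) * \<bar>e\<bar>" by (simp add: algebra_simps)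
    finally show "norm ((\<Sum>p | prime p \<and> p \<le> N. (cis (e * ln (real p)) - 1) / of_nat p)
       - (ein (\<i> * of_real (e * ln (real N))) - ein 0)) \<le> (C1 + C2 + C3) * \<bar>e\<bar>" .
  qed
qed

section \<open>The product formula and its local factors\<close>

lemma big_omega_mult: "x > 0 \<Longrightarrow> y > 0 \<Longrightarrow> big_omega (x * y) = big_omega x + big_omega y"
  by (simp add: big_omega_def prime_factorization_mult)

lemma big_omega_1: "big_omega (Suc 0) = 0"
  by (simp add: big_omega_def)

lemma big_omega_prime: "prime p \<Longrightarrow> big_omega p = 1"
  by (simp add: big_omega_def prime_factorization_prime)

text \<open>A finite Euler product: by unique factorization the exponent vectors on \<open>P\<close>
  parametrize \<open>kfree_smooth k N\<close> bijectively, and expanding the product runs through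
  these vectors.\<close>

lemma sum_kfree_smooth_eq_prod:
  fixes h :: "nat \<Rightarrow> 'a :: comm_semiring_1"
  assumes h1: "h 1 = 1" and h_mult: "\<And>x y. x > 0 \<Longrightarrow> y > 0 \<Longrightarrow> h (x * y) = h x * h y"
  shows "(\<Sum>x\<in>kfree_smooth k N. h x) = (\<Prod>p | prime p \<and> p \<le> N. \<Sum>j\<le>k-1. h p ^ j)"
proof -
  define P where "P = {p :: nat. prime p \<and> p \<le> N}"
  have P: "finite P" "\<And>p. p \<in> P \<Longrightarrow> prime p" by (auto simp: P_def)
  define \<phi> where "\<phi> = (\<lambda>\<nu> :: nat \<Rightarrow> nat. \<Prod>p\<in>P. p ^ \<nu> p)"
  have h_pow: "h (p ^ n) = h p ^ n" if "p > 0" for p n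
    using that by (induction n) (auto simp: h_mult h1[simplified])
  have h_prod: "h (\<Prod>p\<in>Q. p ^ \<nu> p) = (\<Prod>p\<in>Q. h p ^ \<nu> p)" if "Q \<subseteq> P" for Q \<nu>
    using finite_subset[OF that P(1)] that
  proof (induction Q rule: finite_induct)
    case (insert p Q)
    have pos: "q > 0" if "q \<in> insert p Q" for q using P(2) insert.prems that prime_gt_0_nat by auto
    have "(\<Prod>p\<in>Q. p ^ \<nu> p) > 0" using pos by (intro prod_pos) auto
    thus ?case using insert pos by (simp add: h_mult h_pow)
  qed (use h1 in auto)
  have "inj_on \<phi> (PiE P (\<lambda>_. {..k-1}))"
  proof (rule inj_onI, rule ext)
    fix \<mu> \<nu> p assume *: "\<mu> \<in> PiE P (\<lambda>_. {..k-1})" "\<nu> \<in> PiE P (\<lambda>_. {..k-1})" "\<phi> \<mu> = \<phi> \<nu>"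
    show "\<mu> p = \<nu> p"
    proof (cases "p \<in> P")
      case True
      have "multiplicity p (\<phi> \<rho>) = \<rho> p" for \<rho>
        unfolding \<phi>_def using P True by (subst multiplicity_prod_prime_powers) auto
      thus ?thesis using *(3) by metis
    qed (use * in \<open>auto simp: PiE_def extensional_def\<close>)
  qed
  moreover have "\<phi> ` (PiE P (\<lambda>_. {..k-1})) = kfree_smooth k N"
  proof (intro equalityI subsetI)
    fix x assume "x \<in> kfree_smooth k N"
    then obtain \<nu> where \<nu>: "x = \<phi> \<nu>" "\<And>p. p \<in> P \<Longrightarrow> \<nu> p \<le> k - 1"
      by (auto simp: kfree_smooth_def \<phi>_def P_def)
    have "x = \<phi> (restrict \<nu> P)" unfolding \<nu>(1) \<phi>_def by (intro prod.cong) auto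
    moreover have "restrict \<nu> P \<in> PiE P (\<lambda>_. {..k-1})" using \<nu>(2) by auto
    ultimately show "x \<in> \<phi> ` (PiE P (\<lambda>_. {..k-1}))" by blast
  next
    fix x assume "x \<in> \<phi> ` (PiE P (\<lambda>_. {..k-1}))"
    thus "x \<in> kfree_smooth k N"
      unfolding kfree_smooth_def \<phi>_def P_def by (force simp: PiE_iff)
  qed
  ultimately have "bij_betw \<phi> (PiE P (\<lambda>_. {..k-1})) (kfree_smooth k N)"
    by (simp add: bij_betw_def)
  hence "(\<Sum>x\<in>kfree_smooth k N. h x) = (\<Sum>\<nu>\<in>PiE P (\<lambda>_. {..k-1}). h (\<phi> \<nu>))"
    by (rule sum.reindex_bij_betw [symmetric])
  also have "\<dots> = (\<Sum>\<nu>\<in>PiE P (\<lambda>_. {..k-1}). \<Prod>p\<in>P. h p ^ \<nu> p)"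
    by (simp add: \<phi>_def h_prod)
  also have "\<dots> = (\<Prod>p\<in>P. \<Sum>j\<le>k-1. h p ^ j)"
    using P by (intro prod_sum_PiE [symmetric]) auto
  finally show ?thesis by (simp add: P_def)
qed

text \<open>The same Euler product is used for the twisted sum with \<open>s = e\<close> and for the
  partition function with \<open>s = 0\<close>.\<close>

lemma phi_Omega_eq_prod:
  fixes t :: real and N :: nat
  defines "e \<equiv> t / ln (real N)"
  shows "phi_Omega k \<alpha> N t = (\<Prod>p | prime p \<and> p \<le> N.
     (\<Sum>j\<le>k-1. (\<alpha> * cis (e * ln (real p)) / of_nat p) ^ j) / (\<Sum>j\<le>k-1. (\<alpha> / of_nat p) ^ j))"
proof -
  define h where "h = (\<lambda>s x. \<alpha> ^ big_omega x * cis (s * ln (real x)) / of_nat x)"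
  have h: "(\<Sum>x\<in>kfree_smooth k N. h s x) =
             (\<Prod>p | prime p \<and> p \<le> N. \<Sum>j\<le>k-1. (\<alpha> * cis (s * ln (real p)) / of_nat p) ^ j)" for s
  proof -
    have "(\<Sum>x\<in>kfree_smooth k N. h s x) = (\<Prod>p | prime p \<and> p \<le> N. \<Sum>j\<le>k-1. h s p ^ j)"
      by (rule sum_kfree_smooth_eq_prod)
         (auto simp: h_def big_omega_1 big_omega_mult power_add ln_mult ring_distribs simp flip: cis_mult)
    also have "\<dots> = (\<Prod>p | prime p \<and> p \<le> N. \<Sum>j\<le>k-1. (\<alpha> * cis (s * ln (real p)) / of_nat p) ^ j)"
      by (intro prod.cong sum.cong refl) (auto simp: h_def big_omega_prime)
    finally show ?thesis .
  qed
  have "Z_Omega k \<alpha> N = (\<Sum>x\<in>kfree_smooth k N. h 0 x)"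
    by (simp add: Z_Omega_def P_Omega_def h_def)
  moreover have "phi_Omega k \<alpha> N t = inverse (Z_Omega k \<alpha> N) * (\<Sum>x\<in>kfree_smooth k N. h e x)"
    by (simp add: phi_Omega_def P_Omega_norm_def P_Omega_def h_def sum_distrib_left xi_def e_def
          cis_conv_exp mult_ac)
  ultimately show ?thesis
    unfolding prod_dividef h by (simp add: field_simps)
qed

section \<open>Local factors\<close>

text \<open>The product of the sum with \<open>1 - w\<close> is \<open>1 - w ^ Suc n\<close>, and
  \<open>norm (1 - w) <= 2\<close>. Since |alpha / p| <= |alpha| / 2 < 1, this keeps all
  denominators away from 0 uniformly in \<open>p\<close>.\<close>

lemma truncated_geometric_ge:
  fixes w :: complex
  assumes "norm w \<le> \<rho>" "\<rho> < 1"
  shows "(1 - \<rho>) / 2 \<le> norm (\<Sum>j\<le>n. w ^ j)"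
proof -
  have \<rho>: "0 \<le> \<rho>" using assms norm_ge_zero order.trans by blast
  have "norm (w ^ Suc n) \<le> \<rho> ^ Suc n" unfolding norm_power using assms by (intro power_mono) auto
  also have "\<dots> \<le> \<rho> ^ 1" using assms \<rho> by (intro power_decreasing) auto
  finally have "1 - \<rho> \<le> norm (1 - w ^ Suc n)"
    using norm_triangle_ineq2[of 1 "w ^ Suc n"] by simp
  also have "1 - w ^ Suc n = (1 - w) * (\<Sum>j\<le>n. w ^ j)"
    by (simp add: sum_gp_basic)
  also have "norm \<dots> \<le> 2 * norm (\<Sum>j\<le>n. w ^ j)"
    unfolding norm_mult using assms norm_triangle_ineq4[of 1 w] by (intro mult_right_mono) auto
  finally show ?thesis by simp
qed

text \<open>
  The factor \<open>r\<close> in the bound comes from \<open>k \<ge> 2\<close>: the function \<open>(\<Sum>j\<le>k-1. z ^ j) * exp (- z)\<close>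
  has vanishing derivative at \<open>0\<close>. It makes the sum of the bounds over all primes converge.
\<close>

lemma local_factor_bound:
  assumes "k \<ge> 2" "\<rho> < 1"
  obtains C where "C \<ge> 0" "\<And>z w r. norm z \<le> r \<Longrightarrow> norm w \<le> r \<Longrightarrow> r \<le> \<rho> \<Longrightarrow>
     norm ((\<Sum>j\<le>k-1. z ^ j) / (\<Sum>j\<le>k-1. w ^ j) * exp (w - z :: complex) - 1) \<le> C * r * norm (z - w)"
proof -
  obtain m where m: "k - 1 = Suc m" using assms(1) by (cases "k - 1") auto
  \<comment> \<open>\<open>B\<close> adds up the coefficients of \<open>g'\<close> and
    \<open>g\<close> beyond the constant term.\<close>
  define B where "B = (\<Sum>j<m. real (j + 2)) + real (m + 1)"
  define C where "C = 2 * B * exp 1 * exp 1 / (1 - \<rho>)"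
  show ?thesis
  proof (rule that)
    show "C \<ge> 0" using assms by (auto simp: C_def B_def intro!: divide_nonneg_nonneg mult_nonneg_nonneg add_nonneg_nonneg sum_nonneg)
  next
    fix z w :: complex and r assume *: "norm z \<le> r" "norm w \<le> r" "r \<le> \<rho>"
    hence r: "0 \<le> r" "r < 1" using assms norm_ge_zero order.trans by (blast, linarith)
    define g where "g = (\<lambda>z::complex. \<Sum>j\<le>Suc m. z ^ j)"
    define g' where "g' = (\<lambda>z::complex. \<Sum>j\<le>m. of_nat (Suc j) * z ^ j)"
    have g': "(g has_field_derivative g' x) (at x within S)" for x S
    proof -
      have "g = (\<lambda>z. 1 + (\<Sum>j\<le>m. z ^ Suc j))"
        by (simp only: g_def sum.atMost_Suc_shift) simp
      moreover have "((\<lambda>z. z ^ Suc j) has_field_derivative of_nat (Suc j) * x ^ j) (at x within S)" for j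
        by (rule DERIV_cong[OF DERIV_power[OF DERIV_ident]]) simp
      ultimately show ?thesis unfolding g'_def
        by (auto intro!: derivative_eq_intros simp del: power_Suc of_nat_Suc)
    qed
    \<comment> \<open>Both constant terms are 1, as \<open>k - 1 = Suc m\<close> provides
      \<open>g\<close> with a linear term. They cancel and leave a factor \<open>x\<close>.\<close>
    have gg': "norm (g' x - g x) \<le> B * norm x" if "norm x \<le> 1" for x
    proof -
      have pow: "norm x ^ Suc j \<le> norm x" for j
        using power_decreasing[of 1 "Suc j" "norm x"] that by simp
      have "g' x = 1 + (\<Sum>j<m. of_nat (j + 2) * x ^ Suc j)"
        unfolding g'_def by (subst lessThan_Suc_atMost[symmetric], subst sum.lessThan_Suc_shift) simp
      moreover have "g x = 1 + (\<Sum>j\<le>m. x ^ Suc j)"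
        by (simp only: g_def sum.atMost_Suc_shift) simp
      ultimately have "g' x - g x = (\<Sum>j<m. of_nat (j + 2) * x ^ Suc j) - (\<Sum>j\<le>m. x ^ Suc j)" by simp
      also have "norm \<dots> \<le> (\<Sum>j<m. real (j + 2) * norm x) + (\<Sum>j\<le>m. norm x)"
      proof (intro order.trans[OF norm_triangle_ineq4] add_mono sum_norm_le)
        fix j show "norm (of_nat (j + 2) * x ^ Suc j) \<le> real (j + 2) * norm x"
          unfolding norm_mult norm_power norm_of_nat by (intro mult_left_mono pow) auto
        show "norm (x ^ Suc j) \<le> norm x" unfolding norm_power by (rule pow)
      qed
      also have "\<dots> = B * norm x" by (simp add: B_def sum_distrib_right distrib_right)
      finally show ?thesis .
    qed
    have B0: "0 \<le> B" by (auto simp: B_def intro!: add_nonneg_nonneg sum_nonneg)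
    have exp_le: "norm (exp x) \<le> exp 1" if "norm x \<le> 1" for x :: complex
      using that norm_exp[of x] by (meson exp_le_cancel_iff order.trans)
    \<comment> \<open>Mean value inequality on the disc of radius \<open>r\<close>, where the
      derivative \<open>(g' x - g x) * exp (- x)\<close> is O(r).\<close>
    have "norm (g z * exp (- z) - g w * exp (- w)) \<le> (B * r * exp 1) * norm (z - w)"
    proof (rule field_differentiable_bound[of "cball 0 r"])
      fix x :: complex assume "x \<in> cball 0 r"
      hence x: "norm x \<le> r" by simp
      show "((\<lambda>z. g z * exp (- z)) has_field_derivative ((g' x - g x) * exp (- x))) (at x within cball 0 r)"
        by (auto intro!: derivative_eq_intros g' simp: algebra_simps)
      have "norm (g' x - g x) \<le> B * norm x" using x r by (intro gg') auto
      also have "\<dots> \<le> B * r" using x by (intro mult_left_mono) (auto simp: B_def intro!: add_nonneg_nonneg sum_nonneg)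
      finally show "norm ((g' x - g x) * exp (- x)) \<le> B * r * exp 1"
        unfolding norm_mult using x r by (intro mult_mono exp_le) (auto intro: order.trans[OF norm_ge_zero])
    qed (use * in auto)
    moreover have gw: "(1 - \<rho>) / 2 \<le> norm (g w)"
      unfolding g_def using * assms by (intro truncated_geometric_ge) auto
    moreover have gw0: "g w \<noteq> 0" using gw assms(2) by auto
    moreover have "norm (exp w) \<le> exp 1" using * r by (intro exp_le) auto
    ultimately have "norm (g z * exp (- z) - g w * exp (- w)) * norm (exp w) / norm (g w) \<le> 
        ((B * r * exp 1) * norm (z - w)) * exp 1 / ((1 - \<rho>) / 2)"
      using assms r B0 by (intro frac_le mult_mono mult_nonneg_nonneg) auto
    also have "norm (g z * exp (- z) - g w * exp (- w)) * norm (exp w) / norm (g w) = 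
                norm ((g z * exp (- z) - g w * exp (- w)) * exp w / g w)"
      by (simp add: norm_mult norm_divide)
    also have "(g z * exp (- z) - g w * exp (- w)) * exp w / g w = g z / g w * exp (w - z) - 1"
      using gw0 by (simp add: field_simps exp_diff exp_minus)
    also have "((B * r * exp 1) * norm (z - w)) * exp 1 / ((1 - \<rho>) / 2) = C * r * norm (z - w)"
      by (simp add: C_def)
    finally show "norm ((\<Sum>j\<le>k-1. z ^ j) / (\<Sum>j\<le>k-1. w ^ j) * exp (w - z) - 1) \<le> C * r * norm (z - w)"
      by (simp only: m g_def)
  qed
qed

section \<open>The main estimate\<close>

lemma norm_exp_minus_1_le:
  fixes z :: complex
  assumes "norm z \<le> a"
  shows "norm (exp z - 1) \<le> a * exp a"
proof -
  have "norm (exp z - 1) \<le> exp \<bar>Re z\<bar> * norm z"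
    using Taylor_exp[of z 0] by simp
  also have "\<dots> \<le> exp a * a"
    using assms abs_Re_le_cmod[of z] by (intro mult_mono) auto
  finally show ?thesis by (simp add: mult.commute)
qed

text \<open>At \<open>p\<close> the local bound applies with \<open>r\<close> equal to |alpha| / p,
  and the two arguments differ by at most |alpha e| ln p / p. The deviations are thus O(|e| ln p /
  p^2), summable over the primes.\<close>

lemma prod_local_factors_bound:
  assumes "k \<ge> 2" "norm \<alpha> < 2"
  obtains C where "C \<ge> 0" "\<And>e N. \<bar>e\<bar> \<le> 1 \<Longrightarrow>
    norm ((\<Prod>p | prime p \<and> p \<le> N.
       (\<Sum>j\<le>k-1. (\<alpha> * cis (e * ln (real p)) / of_nat p) ^ j) / (\<Sum>j\<le>k-1. (\<alpha> / of_nat p) ^ j)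
       * exp (\<alpha> / of_nat p - \<alpha> * cis (e * ln (real p)) / of_nat p)) - 1) \<le> C * \<bar>e\<bar>"
proof -
  obtain B where B: "B \<ge> 0" "\<And>z w r. norm z \<le> r \<Longrightarrow> norm w \<le> r \<Longrightarrow> r \<le> norm \<alpha> / 2 \<Longrightarrow>
     norm ((\<Sum>j\<le>k-1. z ^ j) / (\<Sum>j\<le>k-1. w ^ j) * exp (w - z :: complex) - 1) \<le> B * r * norm (z - w)"
    using local_factor_bound[of k "norm \<alpha> / 2"] assms by auto
  define D where "D = (\<Sum>p. 2 * real p powr (-3/2))"
  have sm: "summable (\<lambda>p. 2 * real p powr (-3/2))"
    by (intro summable_mult) (auto simp: summable_real_powr_iff)
  have D: "D \<ge> 0" unfolding D_def by (intro suminf_nonneg sm) auto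
  define A where "A = B * norm \<alpha> ^ 2 * D"
  have A: "A \<ge> 0" using B D by (simp add: A_def)
  show ?thesis
  proof (rule that)
    show "A * exp A \<ge> 0" using A by simp
  next
    fix e :: real and N :: nat assume e: "\<bar>e\<bar> \<le> 1"
    define P where "P = {p :: nat. prime p \<and> p \<le> N}"
    define z where "z = (\<lambda>p. \<alpha> * cis (e * ln (real p)) / of_nat p)"
    define w where "w = (\<lambda>p. \<alpha> / of_nat p)"
    define R where "R = (\<lambda>p. (\<Sum>j\<le>k-1. z p ^ j) / (\<Sum>j\<le>k-1. w p ^ j) * exp (w p - z p) - 1)"
    have R: "norm (R p) \<le> B * norm \<alpha> ^ 2 * \<bar>e\<bar> * (2 * real p powr (-3/2))" if p: "p \<in> P" for p
    proof -
      have p2: "real p \<ge> 2" using p prime_ge_2_nat by (auto simp: P_def)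
      have "norm (R p) \<le> B * (norm \<alpha> / p) * norm (z p - w p)"
        unfolding R_def
      proof (rule B(2))
        show "norm \<alpha> / p \<le> norm \<alpha> / 2" using p2 by (intro divide_left_mono) auto
      qed (auto simp: z_def w_def norm_mult norm_divide)
      also have "norm (z p - w p) = norm \<alpha> / p * norm (cis (e * ln (real p)) - cis 0)"
      proof -
        have "z p - w p = \<alpha> / of_nat p * (cis (e * ln (real p)) - cis 0)"
          by (simp add: z_def w_def algebra_simps)
        thus ?thesis by (simp only: norm_mult norm_divide norm_of_nat)
      qed
      also have "B * (norm \<alpha> / p) * (norm \<alpha> / p * norm (cis (e * ln (real p)) - cis 0)) \<le>
          B * (norm \<alpha> / p) * (norm \<alpha> / p * (\<bar>e\<bar> * (2 * sqrt p)))"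
      proof (intro mult_left_mono)
        have "norm (cis (e * ln (real p)) - cis 0) \<le> \<bar>e * ln p - 0\<bar>" by (rule norm_cis_diff_le)
        also have "\<dots> = \<bar>e\<bar> * ln p" using p2 by (simp add: abs_mult)
        also have "\<dots> \<le> \<bar>e\<bar> * (2 * sqrt p)" 
          using p2 ln_bound[of "sqrt p"] by (intro mult_left_mono) (auto simp: ln_sqrt)
        finally show "norm (cis (e * ln (real p)) - cis 0) \<le> \<bar>e\<bar> * (2 * sqrt p)" .
      qed (use B in auto)
      also have "B * (norm \<alpha> / p) * (norm \<alpha> / p * (\<bar>e\<bar> * (2 * sqrt p))) = 
          B * norm \<alpha> ^ 2 * \<bar>e\<bar> * (2 * (sqrt p / real p ^ 2))"
        by (simp add: power2_eq_square)
      also have "sqrt p / real p ^ 2 = real p powr (-3/2)"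
        using p2 by (simp add: powr_half_sqrt [symmetric] powr_diff [symmetric] flip: powr_numeral)
      finally show ?thesis .
    qed
    have "norm ((\<Prod>p\<in>P. 1 + R p) - 1) \<le> (\<Prod>p\<in>P. 1 + norm (R p)) - 1"
      by (rule norm_prod_minus1_le_prod_minus1)
    also have "(\<Prod>p\<in>P. 1 + norm (R p)) \<le> (\<Prod>p\<in>P. exp (norm (R p)))"
      by (intro prod_mono) (auto simp: add.commute intro: add_nonneg_nonneg)
    also have "\<dots> = exp (\<Sum>p\<in>P. norm (R p))" by (subst exp_sum) (auto simp: P_def)
    also have "\<dots> \<le> exp (A * \<bar>e\<bar>)"
    proof -
      have "(\<Sum>p\<in>P. norm (R p)) \<le> (\<Sum>p\<in>P. B * norm \<alpha> ^ 2 * \<bar>e\<bar> * (2 * real p powr (-3/2)))"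
        by (intro sum_mono R)
      also have "\<dots> = B * norm \<alpha> ^ 2 * \<bar>e\<bar> * (\<Sum>p\<in>P. 2 * real p powr (-3/2))"
        by (rule sum_distrib_left [symmetric])
      also have "(\<Sum>p\<in>P. 2 * real p powr (-3/2)) \<le> D"
        unfolding D_def by (intro sum_le_suminf sm) (auto simp: P_def)
      hence "B * norm \<alpha> ^ 2 * \<bar>e\<bar> * (\<Sum>p\<in>P. 2 * real p powr (-3/2)) \<le> 
             B * norm \<alpha> ^ 2 * \<bar>e\<bar> * D"
        using B by (intro mult_left_mono) auto
      finally show ?thesis by (simp add: A_def mult_ac)
    qed
    \<comment> \<open>From \<open>1 - x <= exp (- x)\<close>, multiplied by
      \<open>exp x\<close>.\<close>
    also have "exp (A * \<bar>e\<bar>) - 1 \<le> A * \<bar>e\<bar> * exp (A * \<bar>e\<bar>)"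
    proof -
      have "exp (A * \<bar>e\<bar>) * (1 + - (A * \<bar>e\<bar>)) \<le> exp (A * \<bar>e\<bar>) * exp (- (A * \<bar>e\<bar>))"
        by (intro mult_left_mono exp_ge_add_one_self) auto
      thus ?thesis by (simp add: exp_minus algebra_simps)
    qed
    also have "\<dots> \<le> A * \<bar>e\<bar> * exp A"
      using A e by (intro mult_left_mono) (auto intro: mult_left_le)
    finally show "norm ((\<Prod>p | prime p \<and> p \<le> N.
       (\<Sum>j\<le>k-1. (\<alpha> * cis (e * ln (real p)) / of_nat p) ^ j) / (\<Sum>j\<le>k-1. (\<alpha> / of_nat p) ^ j)
       * exp (\<alpha> / of_nat p - \<alpha> * cis (e * ln (real p)) / of_nat p)) - 1) \<le> A * exp A * \<bar>e\<bar>"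
      by (simp add: P_def R_def z_def w_def mult_ac)
  qed
qed

text \<open>Splitting off the exponentials gives \<open>phi_Omega = R * exp (\<alpha> * S)\<close>,
  where \<open>R - 1\<close> and \<open>S - G\<close> are both O(|e|).\<close>

lemma phi_Omega_approx:
  assumes "k \<ge> 2" "norm \<alpha> < 2"
  obtains C where "\<And>t N. N \<ge> 2 \<Longrightarrow> t \<noteq> 0 \<Longrightarrow> \<bar>t / ln (real N)\<bar> \<le> 1/10 \<Longrightarrow>
    norm (phi_Omega k \<alpha> N t / phi_limit \<alpha> t - 1) \<le> C * \<bar>t / ln (real N)\<bar>"
proof -
  obtain A where A: "A \<ge> 0" "\<And>e N. \<bar>e\<bar> \<le> 1 \<Longrightarrow>
    norm ((\<Prod>p | prime p \<and> p \<le> N.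
       (\<Sum>j\<le>k-1. (\<alpha> * cis (e * ln (real p)) / of_nat p) ^ j) / (\<Sum>j\<le>k-1. (\<alpha> / of_nat p) ^ j)
       * exp (\<alpha> / of_nat p - \<alpha> * cis (e * ln (real p)) / of_nat p)) - 1) \<le> A * \<bar>e\<bar>"
    using prod_local_factors_bound[OF assms] by auto
  obtain C where C: "\<And>e N. e \<noteq> 0 \<Longrightarrow> \<bar>e\<bar> \<le> 1/10 \<Longrightarrow> N \<ge> 2 \<Longrightarrow>
     norm ((\<Sum>p | prime p \<and> p \<le> N. (cis (e * ln (real p)) - 1) / of_nat p)
       - (ein (\<i> * of_real (e * ln (real N))) - ein 0)) \<le> C * \<bar>e\<bar>"
    by (rule sum_primes_cis_minus_1) blast
  define K where "K = norm \<alpha> * C"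
  show ?thesis
  proof (rule that)
    fix t :: real and N :: nat
    assume N: "N \<ge> 2" and t: "t \<noteq> 0" "\<bar>t / ln (real N)\<bar> \<le> 1/10"
    define e where "e = t / ln (real N)"
    have e: "e \<noteq> 0" "\<bar>e\<bar> \<le> 1 / 10" using t N by (auto simp: e_def)
    have eN: "e * ln (real N) = t" using N by (simp add: e_def)
    define P where "P = {p :: nat. prime p \<and> p \<le> N}"
    define z where "z = (\<lambda>p. \<alpha> * cis (e * ln (real p)) / of_nat p)"
    define w where "w = (\<lambda>p. \<alpha> / of_nat p)"
    define R where "R = (\<Prod>p\<in>P. (\<Sum>j\<le>k-1. z p ^ j) / (\<Sum>j\<le>k-1. w p ^ j) * exp (w p - z p))"
    define G where "G = ein (\<i> * of_real t) - ein 0"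
    define S where "S = (\<Sum>p\<in>P. (cis (e * ln (real p)) - 1) / of_nat p)"
    define \<delta> where "\<delta> = \<alpha> * (S - G)"
    have R: "norm (R - 1) \<le> A * \<bar>e\<bar>"
      using A(2)[of e N] e by (simp add: R_def P_def z_def w_def)
    have "norm (S - G) \<le> C * \<bar>e\<bar>"
      using C[OF e N] unfolding eN by (simp add: S_def P_def G_def)
    hence \<delta>: "norm \<delta> \<le> K * \<bar>e\<bar>"
      unfolding \<delta>_def norm_mult K_def mult.assoc by (intro mult_left_mono) auto
    \<comment> \<open>The sign of \<open>C\<close> is not recorded, so nonnegativity of
      \<open>K\<close> is recovered from the norm bound and \<open>e \<noteq> 0\<close>.\<close>
    have "0 \<le> K * \<bar>e\<bar>" using \<delta> norm_ge_zero order.trans by blast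
    hence K: "0 \<le> K" using e by (simp add: zero_le_mult_iff)
    have K': "K * \<bar>e\<bar> \<le> K" using K e by (intro mult_left_le) auto
    have "(\<Sum>p\<in>P. w p - z p) = - (\<alpha> * S)"
      by (simp add: S_def w_def z_def sum_distrib_left flip: sum_negf)
         (intro sum.cong refl, simp add: algebra_simps diff_divide_distrib)
    moreover have "R = phi_Omega k \<alpha> N t * exp (\<Sum>p\<in>P. w p - z p)"
      unfolding R_def prod.distrib phi_Omega_eq_prod e_def[symmetric]
      by (subst exp_sum) (simp_all add: P_def z_def w_def)
    ultimately have "phi_Omega k \<alpha> N t = R * exp (\<alpha> * S)"
      by (simp add: exp_minus)
    moreover have "phi_limit \<alpha> t = exp (\<alpha> * G)"
      by (simp add: phi_limit_eq_ein G_def)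
    ultimately have "phi_Omega k \<alpha> N t / phi_limit \<alpha> t - 1 = (R - 1) * exp \<delta> + (exp \<delta> - 1)"
      by (simp add: \<delta>_def exp_diff right_diff_distrib left_diff_distrib diff_divide_distrib)
    also have "norm \<dots> \<le> norm (R - 1) * norm (exp \<delta>) + norm (exp \<delta> - 1)"
      by (metis norm_mult norm_triangle_ineq)
    also have "\<dots> \<le> A * \<bar>e\<bar> * exp K + K * \<bar>e\<bar> * exp K"
    proof (intro add_mono mult_mono)
      show "norm (exp \<delta>) \<le> exp K"
        using norm_exp[of \<delta>] \<delta> K' by (meson exp_le_cancel_iff order.trans)
      have "norm (exp \<delta> - 1) \<le> K * \<bar>e\<bar> * exp (K * \<bar>e\<bar>)" by (rule norm_exp_minus_1_le[OF \<delta>])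
      also have "\<dots> \<le> K * \<bar>e\<bar> * exp K" using K K' by (intro mult_left_mono) auto
      finally show "norm (exp \<delta> - 1) \<le> K * \<bar>e\<bar> * exp K" .
    qed (use A R in auto)
    also have "\<dots> = (A + K) * exp K * \<bar>e\<bar>" by (simp add: algebra_simps)
    finally show "norm (phi_Omega k \<alpha> N t / phi_limit \<alpha> t - 1) \<le> (A + K) * exp K * \<bar>t / ln (real N)\<bar>"
      by (simp only: e_def)
  qed
qed

text \<open>The normalized measure has total mass 1, its local factors being nonzero for |alpha| <
  2. This treats the frequency 0 separately.\<close>

lemma phi_Omega_0:
  assumes "norm \<alpha> < 2"
  shows "phi_Omega k \<alpha> N 0 = 1"
proof -
  have "(\<Sum>j\<le>k-1. (\<alpha> / of_nat p) ^ j) \<noteq> 0" if "prime p" for p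
  proof -
    have "norm (\<alpha> / of_nat p) \<le> norm \<alpha> / 2"
      using prime_ge_2_nat[OF that] unfolding norm_divide norm_of_nat by (intro divide_left_mono) auto
    from truncated_geometric_ge[OF this, of "k - 1"] assms show ?thesis by auto
  qed
  thus ?thesis by (simp add: phi_Omega_eq_prod)
qed

text \<open>Quantifying \<open>C1\<close> and \<open>C2\<close> before \<open>l\<close> expresses
  that the implied constants depend only on \<open>k\<close> and \<open>\<alpha>\<close>.\<close>

theorem theorem4:
  fixes k :: nat and \<alpha> :: complex
  assumes "k \<ge> 2" and "\<alpha> \<noteq> 0" and "norm \<alpha> < 2"
  shows "\<exists>C1 C2 :: real. \<forall>l :: nat \<Rightarrow> real.
           l \<in> o(\<lambda>N. ln (real N)) \<longrightarrow>
           (\<exists>E1 E2 :: nat \<Rightarrow> complex. \<forall>\<^sub>F N in sequentially.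
              phi_Omega k \<alpha> N (l N) = phi_limit \<alpha> (l N) * (1 + E1 N + E2 N) \<and>
              norm (E1 N) \<le> C1 * (1 / ln (real N)) \<and>
              (let \<epsilon> = l N / ln (real N) in norm (E2 N) \<le> C2 * \<bar>\<epsilon> * ln \<bar>\<epsilon>\<bar>\<bar>))"
proof -
  obtain C where C: "\<And>t N. N \<ge> 2 \<Longrightarrow> t \<noteq> 0 \<Longrightarrow> \<bar>t / ln (real N)\<bar> \<le> 1/10 \<Longrightarrow>
    norm (phi_Omega k \<alpha> N t / phi_limit \<alpha> t - 1) \<le> C * \<bar>t / ln (real N)\<bar>"
    using phi_Omega_approx[OF assms(1,3)] by blast
  show ?thesis
  proof (intro exI allI impI)
    fix l :: "nat \<Rightarrow> real" assume l: "l \<in> o(\<lambda>N. ln (real N))"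
    have "\<forall>\<^sub>F N in sequentially. norm (l N) \<le> 1/10 * norm (ln (real N))"
      using l by (intro landau_o.smallD) auto
    \<comment> \<open>The witnesses are \<open>E1 = 0\<close> and the full relative error for
      \<open>E2\<close>, with constants 0 and \<open>\<bar>C\<bar>\<close>.\<close>
    thus "\<forall>\<^sub>F N in sequentially.
              phi_Omega k \<alpha> N (l N) = phi_limit \<alpha> (l N) * (1 + 0 + 
                 (phi_Omega k \<alpha> N (l N) / phi_limit \<alpha> (l N) - 1)) \<and>
              norm (0 :: complex) \<le> 0 * (1 / ln (real N)) \<and>
              (let \<epsilon> = l N / ln (real N) in 
                 norm (phi_Omega k \<alpha> N (l N) / phi_limit \<alpha> (l N) - 1) \<le> \<bar>C\<bar> * \<bar>\<epsilon> * ln \<bar>\<epsilon>\<bar>\<bar>)"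
      using eventually_ge_at_top[of 2]
    proof eventually_elim
      case (elim N)
      define e where "e = l N / ln (real N)"
      have e: "\<bar>e\<bar> \<le> 1/10" using elim by (simp add: e_def field_simps)
      have "norm (phi_Omega k \<alpha> N (l N) / phi_limit \<alpha> (l N) - 1) \<le> \<bar>C\<bar> * \<bar>e * ln \<bar>e\<bar>\<bar>"
      \<comment> \<open>At \<open>l N = 0\<close> the bound is 0, so exact equality is required;
        both functions equal 1 there.\<close>
      proof (cases "l N = 0")
        case True
        thus ?thesis using phi_Omega_0[OF assms(3)] by (simp add: phi_limit_eq_ein)
      next
        case False
        hence e0: "e \<noteq> 0" using elim by (simp add: e_def)
        \<comment> \<open>Below 1 / exp 1 the logarithm has absolute value at least 1, so the bound
          O(|e|) implies the stated one.\<close>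
        have "\<bar>e\<bar> \<le> exp (-1)"
        proof -
          have "exp (1 :: real) \<le> 3" by (rule exp_le)
          hence "1/10 \<le> exp (-1 :: real)" by (simp add: exp_minus field_simps)
          thus ?thesis using e by linarith
        qed
        hence "ln \<bar>e\<bar> \<le> ln (exp (-1))" using e0 by (subst ln_le_cancel_iff) auto
        hence ln_e: "1 \<le> \<bar>ln \<bar>e\<bar>\<bar>" by simp
        have "norm (phi_Omega k \<alpha> N (l N) / phi_limit \<alpha> (l N) - 1) \<le> C * \<bar>e\<bar>"
          unfolding e_def by (rule C) (use elim False e in \<open>auto simp: e_def\<close>)
        also have "\<dots> \<le> \<bar>C\<bar> * (\<bar>e\<bar> * 1)" by (simp add: mult_right_mono)
        also have "\<dots> \<le> \<bar>C\<bar> * (\<bar>e\<bar> * \<bar>ln \<bar>e\<bar>\<bar>)" using ln_e by (intro mult_left_mono) auto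
        finally show ?thesis by (simp add: abs_mult)
      qed
      \<comment> \<open>As an exponential, \<open>phi_limit\<close> never vanishes, so multiplying
        the ratio back recovers \<open>phi_Omega\<close>.\<close>
      thus ?case by (simp add: Let_def e_def phi_limit_def)
    qed
  qed
qed

end
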